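(* Let $H$ be a subgroup of a finite group $G$. The set $S_H(G)=\{[(A,g)]\mid A\in\mathcal{P}_H(G/H),\ g\in G,\ g^{-1}\in A\}$ with the operation $$[(A,g)]\cdot[(B,h)]:=[(h^{-1}A\cup B,gh)]$$ is an inverse semigroup, and the map $$\mathbb{C}S_H(G)\to\mathbb{C}^H_{par}G,\qquad[(A,g)]\mapsto\sum_{B\in\mathcal{P}_H(G/H),\,B\supseteq A}[g][P_B]$$ is an isomorphism of $\mathbb{C}$-algebras.
   Context: $\mathcal{P}_H(G/H):=\{A\subseteq G\mid H\subseteq A\text{ and }A\text{ is a union of left cosets of }H\}$. The symbols $[(A,g)]$ are in bijection with the pairs $(A,g)$. $\mathbb{C}S_H(G)$ is the semigroup algebra of $S_H(G)$ (basis $S_H(G)$, product extended bilinearly). $\mathbb{C}^H_{par}G$ is the associative unital $\mathbb{C}$-algebra generated by the symbols $\{[g]\mid g\in G\}$ subject to the relations, for all $g,g'\in G$ and $h\in H$: $[1_G][g]=[g][1_G]=[g]$; $[g^{-1}][g][g']=[g^{-1}][gg']$; $[g'][g][g^{-1}]=[g'g][g^{-1}]$; $[h][h^{-1}]=[1_G]$. Its unit is $1=[1_G]$. For $B\in\mathcal{P}_H(G/H)$, $[P_B]:=\prod_{g\in B}[g][g^{-1}]\prod_{\bar g\in G\setminus B}(1-[\bar g][\bar g^{-1}])$, where the elements $[g][g^{-1}]$ are commuting idempotents, so the order of the factors is irrelevant. *)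

theory Defs
  imports
    Complex_Main
    "HOL-Library.Poly_Mapping"
    "HOL-Algebra.Algebra"
    "HOL-Algebra.Left_Coset"
    "HOL-Algebra.Algebraic_Closure_Type"
begin

section \<open>Associative unital complex algebras\<close>

text \<open>The locale \<^locale>\<open>algebra\<close> of HOL-Algebra is restricted to commutative algebras,
  hence the following variant. The scalars are the complex numbers, seen as a HOL-Algebra ring.\<close>

definition complex_algebra :: "(complex, 'a, 'm) module_scheme \<Rightarrow> bool" where
  "complex_algebra A \<longleftrightarrow>
     ring A \<and> module (ring_of_type_algebra :: complex ring) A \<and>
     (\<forall>c. \<forall>x \<in> carrier A. \<forall>y \<in> carrier A.
        (c \<odot>\<^bsub>A\<^esub> x) \<otimes>\<^bsub>A\<^esub> y = c \<odot>\<^bsub>A\<^esub> (x \<otimes>\<^bsub>A\<^esub> y) \<and>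
        x \<otimes>\<^bsub>A\<^esub> (c \<odot>\<^bsub>A\<^esub> y) = c \<odot>\<^bsub>A\<^esub> (x \<otimes>\<^bsub>A\<^esub> y))"

definition complex_algebra_iso ::
    "(complex, 'a, 'm) module_scheme \<Rightarrow> (complex, 'b, 'n) module_scheme \<Rightarrow> ('a \<Rightarrow> 'b) set" where
  "complex_algebra_iso A B =
     {f. complex_algebra A \<and> complex_algebra B \<and> f \<in> ring_iso A B \<and>
         (\<forall>c. \<forall>x \<in> carrier A. f (c \<odot>\<^bsub>A\<^esub> x) = c \<odot>\<^bsub>B\<^esub> f x)}"

text \<open>The unit is only meaningful when \<open>S\<close> has the identity given by its field \<open>one\<close>.\<close>

definition semigroup_algebra ::
    "('s, 'm) monoid_scheme \<Rightarrow> (complex, 's \<Rightarrow>\<^sub>0 complex) module" where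
  "semigroup_algebra S =
     \<lparr>carrier = {f. Poly_Mapping.keys f \<subseteq> carrier S},
      monoid.mult = (\<lambda>f f'. \<Sum>s \<in> Poly_Mapping.keys f. \<Sum>t \<in> Poly_Mapping.keys f'.
        Poly_Mapping.single (s \<otimes>\<^bsub>S\<^esub> t) (Poly_Mapping.lookup f s * Poly_Mapping.lookup f' t)),
      one = Poly_Mapping.single \<one>\<^bsub>S\<^esub> 1,
      ring.zero = 0,
      add = (+),
      module.smult = (\<lambda>c. Poly_Mapping.map ((*) c))\<rparr>"

definition linear_extension ::
    "(complex, 'a, 'm) module_scheme \<Rightarrow> ('s \<Rightarrow> 'a) \<Rightarrow> ('s \<Rightarrow>\<^sub>0 complex) \<Rightarrow> 'a" where
  "linear_extension A \<phi> f =
     (\<Oplus>\<^bsub>A\<^esub>s \<in> Poly_Mapping.keys f. Poly_Mapping.lookup f s \<odot>\<^bsub>A\<^esub> \<phi> s)"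

text \<open>The union in the scalar multiplication is independent of the representatives, as in
  \<^const>\<open>rcoset_mult\<close>. An element-wise scaling of cosets would be wrong for the scalar 0.\<close>

definition quotient_algebra ::
    "(complex, 'a, 'm) module_scheme \<Rightarrow> 'a set \<Rightarrow> (complex, 'a set) module" where
  "quotient_algebra A I =
     \<lparr>carrier = carrier (A Quot I),
      monoid.mult = monoid.mult (A Quot I),
      one = \<one>\<^bsub>A Quot I\<^esub>,
      ring.zero = \<zero>\<^bsub>A Quot I\<^esub>,
      add = add (A Quot I),
      module.smult = (\<lambda>c Q. \<Union>x \<in> Q. I +>\<^bsub>A\<^esub> (c \<odot>\<^bsub>A\<^esub> x))\<rparr>"

text \<open>Words over \<open>Y\<close> form a basis of the free unital algebra; the unit is the empty word.\<close>

definition free_algebra :: "'a set \<Rightarrow> (complex, 'a list \<Rightarrow>\<^sub>0 complex) module" where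
  "free_algebra Y = semigroup_algebra \<lparr>carrier = lists Y, monoid.mult = (@), one = []\<rparr>"

definition word :: "'a list \<Rightarrow> ('a list \<Rightarrow>\<^sub>0 complex)" where
  "word w = Poly_Mapping.single w 1"


section \<open>The inverse semigroup\<close>

definition inverse_semigroup :: "('s, 'm) monoid_scheme \<Rightarrow> bool" where
  "inverse_semigroup S \<longleftrightarrow>
     (\<forall>x \<in> carrier S. \<forall>y \<in> carrier S. x \<otimes>\<^bsub>S\<^esub> y \<in> carrier S) \<and>
     (\<forall>x \<in> carrier S. \<forall>y \<in> carrier S. \<forall>z \<in> carrier S.
        (x \<otimes>\<^bsub>S\<^esub> y) \<otimes>\<^bsub>S\<^esub> z = x \<otimes>\<^bsub>S\<^esub> (y \<otimes>\<^bsub>S\<^esub> z)) \<and>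
     (\<forall>x \<in> carrier S. \<exists>!y. y \<in> carrier S \<and>
        (x \<otimes>\<^bsub>S\<^esub> y) \<otimes>\<^bsub>S\<^esub> x = x \<and> (y \<otimes>\<^bsub>S\<^esub> x) \<otimes>\<^bsub>S\<^esub> y = y)"

definition P_H :: "('a, 'm) monoid_scheme \<Rightarrow> 'a set \<Rightarrow> 'a set set" where
  "P_H G H = {A. A \<subseteq> carrier G \<and> H \<subseteq> A \<and> (\<exists>\<C>. \<C> \<subseteq> lcosets\<^bsub>G\<^esub> H \<and> A = \<Union>\<C>)}"

text \<open>The symbol \<open>[(A,g)]\<close> is the pair itself. The pair \<open>(H, 1)\<close> is the identity element
  and provides the unit of the semigroup algebra.\<close>

definition S_H :: "('a, 'm) monoid_scheme \<Rightarrow> 'a set \<Rightarrow> ('a set \<times> 'a) monoid" where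
  "S_H G H =
     \<lparr>carrier = {(A, g). A \<in> P_H G H \<and> g \<in> carrier G \<and> inv\<^bsub>G\<^esub> g \<in> A},
      monoid.mult = (\<lambda>(A, g) (B, h). ((inv\<^bsub>G\<^esub> h <#\<^bsub>G\<^esub> A) \<union> B, g \<otimes>\<^bsub>G\<^esub> h)),
      one = (H, \<one>\<^bsub>G\<^esub>)\<rparr>"


section \<open>The partial group algebra relative to \<open>H\<close>\<close>

text \<open>A relation \<open>u = v\<close> is encoded as the difference \<open>u - v\<close>. The relation
  \<open>[1] = 1\<close>, with \<open>1\<close> the empty word, is needed because the unit of the free unital algebra
  is not one of the generators; without it \<open>[1]\<close> would only be a proper idempotent.\<close>

definition par_relations ::
    "('a, 'm) monoid_scheme \<Rightarrow> 'a set \<Rightarrow> ('a list \<Rightarrow>\<^sub>0 complex) set" where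
  "par_relations G H =
     {word [\<one>\<^bsub>G\<^esub>] - word []} \<union>
     {word [\<one>\<^bsub>G\<^esub>, g] - word [g] | g. g \<in> carrier G} \<union>
     {word [g, \<one>\<^bsub>G\<^esub>] - word [g] | g. g \<in> carrier G} \<union>
     {word [inv\<^bsub>G\<^esub> g, g, g'] - word [inv\<^bsub>G\<^esub> g, g \<otimes>\<^bsub>G\<^esub> g'] | g g'. g \<in> carrier G \<and> g' \<in> carrier G} \<union>
     {word [g', g, inv\<^bsub>G\<^esub> g] - word [g' \<otimes>\<^bsub>G\<^esub> g, inv\<^bsub>G\<^esub> g] | g g'. g \<in> carrier G \<and> g' \<in> carrier G} \<union>
     {word [h, inv\<^bsub>G\<^esub> h] - word [\<one>\<^bsub>G\<^esub>] | h. h \<in> H}"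

definition par_ideal ::
    "('a, 'm) monoid_scheme \<Rightarrow> 'a set \<Rightarrow> ('a list \<Rightarrow>\<^sub>0 complex) set" where
  "par_ideal G H = Idl\<^bsub>free_algebra (carrier G)\<^esub> (par_relations G H)"

definition par_algebra ::
    "('a, 'm) monoid_scheme \<Rightarrow> 'a set \<Rightarrow> (complex, ('a list \<Rightarrow>\<^sub>0 complex) set) module" where
  "par_algebra G H = quotient_algebra (free_algebra (carrier G)) (par_ideal G H)"

definition par_gen ::
    "('a, 'm) monoid_scheme \<Rightarrow> 'a set \<Rightarrow> 'a \<Rightarrow> ('a list \<Rightarrow>\<^sub>0 complex) set" where
  "par_gen G H g = par_ideal G H +>\<^bsub>free_algebra (carrier G)\<^esub> word [g]"

definition par_idem ::
    "('a, 'm) monoid_scheme \<Rightarrow> 'a set \<Rightarrow> 'a \<Rightarrow> ('a list \<Rightarrow>\<^sub>0 complex) set" where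
  "par_idem G H g = par_gen G H g \<otimes>\<^bsub>par_algebra G H\<^esub> par_gen G H (inv\<^bsub>G\<^esub> g)"

text \<open>The algebra is not commutative, but \<^const>\<open>finprod\<close> is still the product of the factors
  in any order: these commute pairwise, which makes the underlying \<^const>\<open>foldD\<close>
  well-defined (see the locale \<^locale>\<open>LCD\<close>).\<close>

definition par_P ::
    "('a, 'm) monoid_scheme \<Rightarrow> 'a set \<Rightarrow> 'a set \<Rightarrow> ('a list \<Rightarrow>\<^sub>0 complex) set" where
  "par_P G H B =
     (\<Otimes>\<^bsub>par_algebra G H\<^esub>g \<in> B. par_idem G H g) \<otimes>\<^bsub>par_algebra G H\<^esub>
     (\<Otimes>\<^bsub>par_algebra G H\<^esub>g \<in> carrier G - B.
        \<one>\<^bsub>par_algebra G H\<^esub> \<ominus>\<^bsub>par_algebra G H\<^esub> par_idem G H g)"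

end

(*
  Write e_g = [g][g^-1]. Expanding the product of all e_a + (1 - e_a) with a outside A shows
  that the sum of the [P_B] over all supersets B of A is the product E_A of the e_a with a in A;
  the terms with B not in P_H(G/H) vanish since e_{gh} = e_g for h in H. Hence the map phi of the
  theorem sends [(A,g)] to [g] E_A, and from this phi(s_g x) = [g] phi(x) for the element
  s_g = [(H \<union> g^-1 H, g)].

  The elements s_g generate S_H(G) and satisfy the defining relations of the partial group
  algebra. So the surjection psi from the free algebra to C S_H(G) sending each letter g to s_g
  factors through the projection pi onto the partial group algebra. Since phi o psi = pi, the
  map phi is a homomorphism, is surjective, and is injective because ker pi lies in ker psi.
*)
theory Submission
  imports Defs
begin

section \<open>Complex algebras\<close>

text \<open>The product of two arbitrary symbols is never pushed through phi, and no inverse of phi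
  is constructed: only left multiplication by s_g is computed, and words in the s_g do the rest. The
  set H \<union> g^-1 H is the smallest member of P_H(G/H) containing g^-1, and phi(s_g) = [g]
  because e_h = 1 for h in H and [g] e_(g^-1) = [g]. Two obstacles shape the development. Elements
  of the partial group algebra are cosets of polynomials in words, which are awkward to compute
  with; so the e_g, the [P_B] and phi are studied for any family p that satisfies the relations in
  any ring, and the quotient enters as an instance. That ring is not commutative, so finite products
  are set up for pairwise commuting families. Finiteness of G makes the products defining [P_B]
  finite and lets every A be reached by finitely many factors s_a s_(a^-1).\<close>

locale complex_alg = ring A for A :: "(complex, 'b, 'n) module_scheme" (structure) +
  assumes complex_algebra: "complex_algebra A"
begin

lemma module: "module (ring_of_type_algebra :: complex ring) A"
  using complex_algebra by (simp add: complex_algebra_def)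

lemma smult_closed [simp, intro]: "x \<in> carrier A \<Longrightarrow> c \<odot> x \<in> carrier A"
  using module.smult_closed[OF module, of c x] by (simp add: ring_of_type_algebra_def)

lemma smult_l_distr: "x \<in> carrier A \<Longrightarrow> (c + d) \<odot> x = c \<odot> x \<oplus> d \<odot> x"
  using module.smult_l_distr[OF module, of c d x] by (simp add: ring_of_type_algebra_def)

lemma smult_r_distr:
  "x \<in> carrier A \<Longrightarrow> y \<in> carrier A \<Longrightarrow> c \<odot> (x \<oplus> y) = c \<odot> x \<oplus> c \<odot> y"
  using module.smult_r_distr[OF module, of c x y] by (simp add: ring_of_type_algebra_def)

lemma smult_assoc1: "x \<in> carrier A \<Longrightarrow> (c * d) \<odot> x = c \<odot> (d \<odot> x)"
  using module.smult_assoc1[OF module, of c d x] by (simp add: ring_of_type_algebra_def)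

lemma smult_one [simp]: "x \<in> carrier A \<Longrightarrow> 1 \<odot> x = x"
  using module.smult_one[OF module, of x] by (simp add: ring_of_type_algebra_def)

lemma smult_mult_l:
  "x \<in> carrier A \<Longrightarrow> y \<in> carrier A \<Longrightarrow> (c \<odot> x) \<otimes> y = c \<odot> (x \<otimes> y)"
  using complex_algebra by (simp add: complex_algebra_def)

lemma smult_mult_r:
  "x \<in> carrier A \<Longrightarrow> y \<in> carrier A \<Longrightarrow> x \<otimes> (c \<odot> y) = c \<odot> (x \<otimes> y)"
  using complex_algebra by (simp add: complex_algebra_def)

lemma smult_zero_l [simp]: "x \<in> carrier A \<Longrightarrow> 0 \<odot> x = \<zero>"
  using smult_l_distr[of x 0 0] by (metis add.l_cancel_one smult_closed add_0)

lemma smult_zero_r [simp]: "c \<odot> \<zero> = \<zero>"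
  using smult_r_distr[of \<zero> \<zero> c] by (metis add.l_cancel_one smult_closed l_zero zero_closed)

text \<open>\<open>c \<odot> i\<close> is the product of \<open>c \<odot> \<one>\<close> and
  \<open>i\<close>, so a ring ideal is automatically a subspace. Hence the ideal generated in the
  ring sense is the right one to divide the algebra by.\<close>

lemma smult_ideal:
  assumes "ideal I A" "i \<in> I"
  shows "c \<odot> i \<in> I"
proof -
  interpret I: ideal I A by fact
  have "i \<in> carrier A" using assms(2) I.a_subset by blast
  then have "c \<odot> i = (c \<odot> \<one>) \<otimes> i" by (simp add: smult_mult_l)
  then show ?thesis using assms(2) by (simp add: I.I_l_closed)
qed

end

lemma complex_algI: "complex_algebra A \<Longrightarrow> complex_alg A"
  by (simp add: complex_alg_def complex_alg_axioms_def complex_algebra_def)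

lemma complex_algebraI:
  fixes A (structure)
  assumes "ring A"
    and closed: "\<And>c x. x \<in> carrier A \<Longrightarrow> c \<odot> x \<in> carrier A"
    and "\<And>c d x. x \<in> carrier A \<Longrightarrow> (c + d) \<odot> x = c \<odot> x \<oplus> d \<odot> x"
    and "\<And>c x y. x \<in> carrier A \<Longrightarrow> y \<in> carrier A \<Longrightarrow> c \<odot> (x \<oplus> y) = c \<odot> x \<oplus> c \<odot> y"
    and "\<And>c d x. x \<in> carrier A \<Longrightarrow> (c * d) \<odot> x = c \<odot> (d \<odot> x)"
    and "\<And>x. x \<in> carrier A \<Longrightarrow> 1 \<odot> x = x"
    and "\<And>c x y. x \<in> carrier A \<Longrightarrow> y \<in> carrier A \<Longrightarrow> (c \<odot> x) \<otimes> y = c \<odot> (x \<otimes> y)"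
    and "\<And>c x y. x \<in> carrier A \<Longrightarrow> y \<in> carrier A \<Longrightarrow> x \<otimes> (c \<odot> y) = c \<odot> (x \<otimes> y)"
  shows "complex_algebra A"
proof -
  have "module (ring_of_type_algebra :: complex ring) A"
    by (rule moduleI)
      (use assms ring.is_abelian_group[OF assms(1)] in
        \<open>auto simp: ring_of_type_algebra_def intro: cring_from_type_algebra[unfolded ring_of_type_algebra_def]\<close>)
  then show ?thesis using assms by (simp add: complex_algebra_def)
qed

section \<open>Semigroup algebras\<close>

lemma keys_add_subset:
  "Poly_Mapping.keys f \<subseteq> C \<Longrightarrow> Poly_Mapping.keys g \<subseteq> C \<Longrightarrow> Poly_Mapping.keys (f + g) \<subseteq> C"
  using Poly_Mapping.keys_add[of f g] by blast

text \<open>A finitely supported function is the sum of its \<open>single\<close> parts. Both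
  summands of the \<open>add\<close> case stay supported in \<open>C\<close>, so a multilinear
  identity that is known only on a carrier reduces to basis elements of that carrier.\<close>

lemma poly_mapping_keys_induct [consumes 1, case_names zero single add]:
  fixes f :: "'s \<Rightarrow>\<^sub>0 'b :: comm_monoid_add"
  assumes "Poly_Mapping.keys f \<subseteq> C"
    and zero: "P 0"
    and single: "\<And>s c. s \<in> C \<Longrightarrow> P (Poly_Mapping.single s c)"
    and add: "\<And>f g. Poly_Mapping.keys f \<subseteq> C \<Longrightarrow> Poly_Mapping.keys g \<subseteq> C \<Longrightarrow> P f \<Longrightarrow> P g \<Longrightarrow> P (f + g)"
  shows "P f"
proof -
  \<comment> \<open>The support bound is carried along because \<open>add\<close> requires it of the
    partial sums.\<close>
  have "Poly_Mapping.keys (\<Sum>s\<in>K. Poly_Mapping.single s (Poly_Mapping.lookup f s)) \<subseteq> C \<and>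
      P (\<Sum>s\<in>K. Poly_Mapping.single s (Poly_Mapping.lookup f s))" if "finite K" "K \<subseteq> C" for K
    using that
  proof (induction K rule: finite_induct)
    case (insert s K)
    then show ?case
      by (simp add: add single keys_add_subset)
  qed (simp add: zero)
  moreover have "f = (\<Sum>s\<in>Poly_Mapping.keys f. Poly_Mapping.single s (Poly_Mapping.lookup f s))"
    by (rule poly_mapping_eqI)
      (simp add: lookup_sum lookup_single when_def sum.delta' in_keys_iff)
  ultimately show ?thesis using assms(1) finite_keys by metis
qed

lemma map_times_complex:
  fixes f g :: "'s \<Rightarrow>\<^sub>0 complex"
  shows "Poly_Mapping.map ((*) c) (f + g) = Poly_Mapping.map ((*) c) f + Poly_Mapping.map ((*) c) g"
    and "Poly_Mapping.map ((*) (c + d)) f = Poly_Mapping.map ((*) c) f + Poly_Mapping.map ((*) d) f"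
    and "Poly_Mapping.map ((*) (c * d)) f = Poly_Mapping.map ((*) c) (Poly_Mapping.map ((*) d) f)"
    and "Poly_Mapping.map ((*) 1) f = f"
    and "Poly_Mapping.map ((*) c) (0 :: 's \<Rightarrow>\<^sub>0 complex) = 0"
proof -
  have "Poly_Mapping.lookup (Poly_Mapping.map ((*) a) h) s = a * Poly_Mapping.lookup h s"
    for a :: complex and h :: "'s \<Rightarrow>\<^sub>0 complex" and s
    by (simp add: Poly_Mapping.map.rep_eq when_def)
  note * = poly_mapping_eqI Poly_Mapping.lookup_add this
  show "Poly_Mapping.map ((*) c) (f + g) = Poly_Mapping.map ((*) c) f + Poly_Mapping.map ((*) c) g"
    "Poly_Mapping.map ((*) (c + d)) f = Poly_Mapping.map ((*) c) f + Poly_Mapping.map ((*) d) f"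
    "Poly_Mapping.map ((*) (c * d)) f = Poly_Mapping.map ((*) c) (Poly_Mapping.map ((*) d) f)"
    "Poly_Mapping.map ((*) 1) f = f"
    "Poly_Mapping.map ((*) c) (0 :: 's \<Rightarrow>\<^sub>0 complex) = 0"
    by (rule poly_mapping_eqI, simp add: * algebra_simps)+
qed

lemma keys_map_subset:
  assumes "Poly_Mapping.keys f \<subseteq> C"
  shows "Poly_Mapping.keys (Poly_Mapping.map h f) \<subseteq> C"
  using assms by (auto simp: in_keys_iff Poly_Mapping.map.rep_eq when_def split: if_splits)

lemma semigroup_algebra_simps:
  "carrier (semigroup_algebra S) = {f. Poly_Mapping.keys f \<subseteq> carrier S}"
  "\<one>\<^bsub>semigroup_algebra S\<^esub> = Poly_Mapping.single \<one>\<^bsub>S\<^esub> 1"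
  "\<zero>\<^bsub>semigroup_algebra S\<^esub> = 0"
  "f \<oplus>\<^bsub>semigroup_algebra S\<^esub> g = f + g"
  "c \<odot>\<^bsub>semigroup_algebra S\<^esub> f = Poly_Mapping.map ((*) c) f"
  by (simp_all add: semigroup_algebra_def)

text \<open>Pairs outside the supports contribute coefficient 0. The freedom in \<open>K\<close> and
  \<open>L\<close> serves distributivity: cancellation can make the support of \<open>f + g\<close>
  smaller than the union of the two supports, so a common index set has to be imposed.\<close>

lemma semigroup_algebra_mult_supset:
  assumes "finite K" "finite L" "Poly_Mapping.keys f \<subseteq> K" "Poly_Mapping.keys g \<subseteq> L"
  shows "f \<otimes>\<^bsub>semigroup_algebra S\<^esub> g =
    (\<Sum>s\<in>K. \<Sum>t\<in>L. Poly_Mapping.single (s \<otimes>\<^bsub>S\<^esub> t) (Poly_Mapping.lookup f s * Poly_Mapping.lookup g t))"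
proof -
  have "f \<otimes>\<^bsub>semigroup_algebra S\<^esub> g =
    (\<Sum>s\<in>Poly_Mapping.keys f. \<Sum>t\<in>Poly_Mapping.keys g.
      Poly_Mapping.single (s \<otimes>\<^bsub>S\<^esub> t) (Poly_Mapping.lookup f s * Poly_Mapping.lookup g t))"
    by (simp add: semigroup_algebra_def)
  also have "\<dots> = (\<Sum>s\<in>Poly_Mapping.keys f. \<Sum>t\<in>L.
      Poly_Mapping.single (s \<otimes>\<^bsub>S\<^esub> t) (Poly_Mapping.lookup f s * Poly_Mapping.lookup g t))"
    by (intro sum.cong sum.mono_neutral_left) (use assms in \<open>auto simp: in_keys_iff\<close>)
  also have "\<dots> = (\<Sum>s\<in>K. \<Sum>t\<in>L.
      Poly_Mapping.single (s \<otimes>\<^bsub>S\<^esub> t) (Poly_Mapping.lookup f s * Poly_Mapping.lookup g t))"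
    by (intro sum.mono_neutral_left) (use assms in \<open>auto simp: in_keys_iff\<close>)
  finally show ?thesis .
qed

lemma semigroup_algebra_mult_single:
  "Poly_Mapping.single s a \<otimes>\<^bsub>semigroup_algebra S\<^esub> Poly_Mapping.single t b =
    Poly_Mapping.single (s \<otimes>\<^bsub>S\<^esub> t) (a * b)"
  by (subst semigroup_algebra_mult_supset[of "{s}" "{t}"]) auto

lemma semigroup_algebra_mult_zero:
  "0 \<otimes>\<^bsub>semigroup_algebra S\<^esub> f = 0" "f \<otimes>\<^bsub>semigroup_algebra S\<^esub> 0 = 0"
  by (simp_all add: semigroup_algebra_def)

lemma semigroup_algebra_l_distr:
  "(f + g) \<otimes>\<^bsub>semigroup_algebra S\<^esub> h =
    f \<otimes>\<^bsub>semigroup_algebra S\<^esub> h + g \<otimes>\<^bsub>semigroup_algebra S\<^esub> h"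
  using Poly_Mapping.keys_add[of f g]
  by (simp add: semigroup_algebra_mult_supset[of "Poly_Mapping.keys f \<union> Poly_Mapping.keys g" "Poly_Mapping.keys h"]
      Poly_Mapping.lookup_add distrib_right single_add sum.distrib)

lemma semigroup_algebra_r_distr:
  "h \<otimes>\<^bsub>semigroup_algebra S\<^esub> (f + g) =
    h \<otimes>\<^bsub>semigroup_algebra S\<^esub> f + h \<otimes>\<^bsub>semigroup_algebra S\<^esub> g"
  using Poly_Mapping.keys_add[of f g]
  by (simp add: semigroup_algebra_mult_supset[of "Poly_Mapping.keys h" "Poly_Mapping.keys f \<union> Poly_Mapping.keys g"]
      Poly_Mapping.lookup_add distrib_left single_add sum.distrib)

lemma semigroup_algebra_smult_mult:
  "Poly_Mapping.map ((*) c) f \<otimes>\<^bsub>semigroup_algebra S\<^esub> g =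
    Poly_Mapping.map ((*) c) (f \<otimes>\<^bsub>semigroup_algebra S\<^esub> g)"
  "f \<otimes>\<^bsub>semigroup_algebra S\<^esub> Poly_Mapping.map ((*) c) g =
    Poly_Mapping.map ((*) c) (f \<otimes>\<^bsub>semigroup_algebra S\<^esub> g)"
proof -
  have f: "Poly_Mapping.keys f \<subseteq> UNIV" and g: "Poly_Mapping.keys g \<subseteq> UNIV" by simp_all
  have *: "Poly_Mapping.map ((*) c) f \<otimes>\<^bsub>semigroup_algebra S\<^esub> g =
      Poly_Mapping.map ((*) c) (f \<otimes>\<^bsub>semigroup_algebra S\<^esub> g) \<and>
    f \<otimes>\<^bsub>semigroup_algebra S\<^esub> Poly_Mapping.map ((*) c) g =
      Poly_Mapping.map ((*) c) (f \<otimes>\<^bsub>semigroup_algebra S\<^esub> g)"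
    using f
  proof (induction f rule: poly_mapping_keys_induct)
    case zero
    then show ?case by (simp add: semigroup_algebra_mult_zero map_times_complex(5))
  next
    case (single s a)
    show ?case using g
      by (induction g rule: poly_mapping_keys_induct)
        (simp_all add: semigroup_algebra_mult_zero semigroup_algebra_mult_single
          semigroup_algebra_r_distr map_times_complex(1,5) mult.assoc mult.left_commute)
  next
    case (add f f')
    then show ?case by (simp add: semigroup_algebra_l_distr map_times_complex(1))
  qed
  then show "Poly_Mapping.map ((*) c) f \<otimes>\<^bsub>semigroup_algebra S\<^esub> g =
      Poly_Mapping.map ((*) c) (f \<otimes>\<^bsub>semigroup_algebra S\<^esub> g)"
    "f \<otimes>\<^bsub>semigroup_algebra S\<^esub> Poly_Mapping.map ((*) c) g =
      Poly_Mapping.map ((*) c) (f \<otimes>\<^bsub>semigroup_algebra S\<^esub> g)" by blast+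
qed

lemma semigroup_algebra_mult_closed:
  assumes "monoid S" "Poly_Mapping.keys f \<subseteq> carrier S" "Poly_Mapping.keys g \<subseteq> carrier S"
  shows "Poly_Mapping.keys (f \<otimes>\<^bsub>semigroup_algebra S\<^esub> g) \<subseteq> carrier S"
  using assms(2)
proof (induction f rule: poly_mapping_keys_induct)
  case (single s a)
  show ?case using assms(3)
  proof (induction g rule: poly_mapping_keys_induct)
    case (add f g)
    then show ?case by (simp add: semigroup_algebra_r_distr keys_add_subset)
  qed (use single monoid.m_closed[OF assms(1)] in
      \<open>simp_all add: semigroup_algebra_mult_zero semigroup_algebra_mult_single\<close>)
next
  case (add f g)
  then show ?case by (simp add: semigroup_algebra_l_distr keys_add_subset)
qed (simp add: semigroup_algebra_mult_zero)

lemma semigroup_algebra_assoc: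
  assumes "monoid S"
    and f: "Poly_Mapping.keys f \<subseteq> carrier S" and g: "Poly_Mapping.keys g \<subseteq> carrier S"
    and h: "Poly_Mapping.keys h \<subseteq> carrier S"
  shows "(f \<otimes>\<^bsub>semigroup_algebra S\<^esub> g) \<otimes>\<^bsub>semigroup_algebra S\<^esub> h =
    f \<otimes>\<^bsub>semigroup_algebra S\<^esub> (g \<otimes>\<^bsub>semigroup_algebra S\<^esub> h)"
  using f
proof (induction f rule: poly_mapping_keys_induct)
  case s: (single s a)
  show ?case using g
  proof (induction g rule: poly_mapping_keys_induct)
    case t: (single t b)
    show ?case using h
    proof (induction h rule: poly_mapping_keys_induct)
      case (single u c)
      then show ?case using s t monoid.m_assoc[OF assms(1)]
        by (simp add: semigroup_algebra_mult_single mult.assoc)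
    qed (simp_all add: semigroup_algebra_mult_zero semigroup_algebra_r_distr)
  qed (simp_all add: semigroup_algebra_mult_zero semigroup_algebra_r_distr semigroup_algebra_l_distr)
qed (simp_all add: semigroup_algebra_mult_zero semigroup_algebra_l_distr)

lemma semigroup_algebra_one:
  assumes "monoid S" "Poly_Mapping.keys f \<subseteq> carrier S"
  shows "Poly_Mapping.single \<one>\<^bsub>S\<^esub> 1 \<otimes>\<^bsub>semigroup_algebra S\<^esub> f = f"
    and "f \<otimes>\<^bsub>semigroup_algebra S\<^esub> Poly_Mapping.single \<one>\<^bsub>S\<^esub> 1 = f"
proof -
  interpret S: monoid S by fact
  have "Poly_Mapping.single \<one>\<^bsub>S\<^esub> 1 \<otimes>\<^bsub>semigroup_algebra S\<^esub> f = f \<and>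
    f \<otimes>\<^bsub>semigroup_algebra S\<^esub> Poly_Mapping.single \<one>\<^bsub>S\<^esub> 1 = f"
    using assms(2)
    by (induction f rule: poly_mapping_keys_induct)
      (simp_all add: semigroup_algebra_mult_zero semigroup_algebra_mult_single
        semigroup_algebra_l_distr semigroup_algebra_r_distr)
  then show "Poly_Mapping.single \<one>\<^bsub>S\<^esub> 1 \<otimes>\<^bsub>semigroup_algebra S\<^esub> f = f"
    "f \<otimes>\<^bsub>semigroup_algebra S\<^esub> Poly_Mapping.single \<one>\<^bsub>S\<^esub> 1 = f" by blast+
qed

lemma complex_algebra_semigroup_algebra:
  assumes "monoid S"
  shows "complex_algebra (semigroup_algebra S)"
proof (rule complex_algebraI)
  interpret S: monoid S by fact
  have "\<exists>g \<in> carrier (semigroup_algebra S). g + f = 0" if "f \<in> carrier (semigroup_algebra S)" for f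
    using that by (intro bexI[of _ "- f"]) (auto simp: semigroup_algebra_simps in_keys_iff)
  then have "abelian_group (semigroup_algebra S)"
    by (intro abelian_groupI)
      (simp_all add: semigroup_algebra_simps ac_simps keys_add_subset)
  moreover have "Group.monoid (semigroup_algebra S)"
    by (rule monoidI)
      (use assms in \<open>simp_all add: semigroup_algebra_simps semigroup_algebra_assoc
        semigroup_algebra_one semigroup_algebra_mult_closed\<close>)
  ultimately show "ring (semigroup_algebra S)"
    by (rule ringI) (simp_all add: semigroup_algebra_simps semigroup_algebra_l_distr semigroup_algebra_r_distr)
qed (simp_all add: semigroup_algebra_simps map_times_complex semigroup_algebra_smult_mult keys_map_subset)

subsection \<open>Linear extension\<close>

context complex_alg
begin

lemma linear_extension_supset:
  assumes "finite K" "K \<subseteq> C" "\<phi> \<in> C \<rightarrow> carrier A" "Poly_Mapping.keys f \<subseteq> K"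
  shows "linear_extension A \<phi> f = (\<Oplus>s\<in>K. Poly_Mapping.lookup f s \<odot> \<phi> s)"
  unfolding linear_extension_def
  by (rule add.finprod_mono_neutral_cong_left)
    (use assms in \<open>auto simp: in_keys_iff Pi_iff subset_iff\<close>)

lemma linear_extension_zero [simp]: "linear_extension A \<phi> 0 = \<zero>"
  by (simp add: linear_extension_def)

lemma linear_extension_single:
  assumes "\<phi> s \<in> carrier A"
  shows "linear_extension A \<phi> (Poly_Mapping.single s c) = c \<odot> \<phi> s"
  using assms by (simp add: linear_extension_def)

lemma linear_extension_closed:
  assumes "\<phi> \<in> C \<rightarrow> carrier A" "Poly_Mapping.keys f \<subseteq> C"
  shows "linear_extension A \<phi> f \<in> carrier A"
  unfolding linear_extension_def by (rule finsum_closed) (use assms in auto)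

lemma linear_extension_add:
  assumes "\<phi> \<in> C \<rightarrow> carrier A" "Poly_Mapping.keys f \<subseteq> C" "Poly_Mapping.keys g \<subseteq> C"
  shows "linear_extension A \<phi> (f + g) = linear_extension A \<phi> f \<oplus> linear_extension A \<phi> g"
proof -
  let ?K = "Poly_Mapping.keys f \<union> Poly_Mapping.keys g"
  have *: "linear_extension A \<phi> h = (\<Oplus>s\<in>?K. Poly_Mapping.lookup h s \<odot> \<phi> s)"
    if "Poly_Mapping.keys h \<subseteq> ?K" for h
    by (rule linear_extension_supset[of _ C]) (use assms that in auto)
  have \<phi>: "\<phi> s \<in> carrier A" if "s \<in> ?K" for s using assms that by auto
  have "linear_extension A \<phi> (f + g) =
      (\<Oplus>s\<in>?K. Poly_Mapping.lookup f s \<odot> \<phi> s \<oplus> Poly_Mapping.lookup g s \<odot> \<phi> s)"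
    unfolding *[OF Poly_Mapping.keys_add] using \<phi>
    by (intro finsum_cong') (auto simp: Poly_Mapping.lookup_add smult_l_distr)
  also have "\<dots> = linear_extension A \<phi> f \<oplus> linear_extension A \<phi> g"
    using \<phi> by (simp add: * finsum_addf)
  finally show ?thesis .
qed

lemma linear_extension_smult:
  assumes "\<phi> \<in> C \<rightarrow> carrier A" "Poly_Mapping.keys f \<subseteq> C"
  shows "linear_extension A \<phi> (Poly_Mapping.map ((*) c) f) = c \<odot> linear_extension A \<phi> f"
  using assms(2)
proof (induction f rule: poly_mapping_keys_induct)
  case zero
  then show ?case by (simp add: map_times_complex(5))
next
  case (single s d)
  then have "\<phi> s \<in> carrier A" using assms(1) by auto
  then show ?case by (simp add: linear_extension_single smult_assoc1)
next
  case (add f g)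
  then show ?case
    by (simp add: map_times_complex(1) linear_extension_add[OF assms(1)] keys_map_subset
        smult_r_distr linear_extension_closed[OF assms(1)])
qed

text \<open>Multiplicativity is an identity between bilinear expressions, hence a matter of
  \<open>single s a\<close> and \<open>single t b\<close>, where it is the multiplicativity of
  \<open>\<phi>\<close>. For the monoid of words this is the universal property of the free
  algebra.\<close>

lemma linear_extension_ring_hom:
  assumes "monoid S" and \<phi>: "\<phi> \<in> hom S A" and one: "\<phi> \<one>\<^bsub>S\<^esub> = \<one>"
  shows "linear_extension A \<phi> \<in> ring_hom (semigroup_algebra S) A"
proof (rule ring_hom_memI)
  interpret S: monoid S by fact
  have Pi: "\<phi> \<in> carrier S \<rightarrow> carrier A" using \<phi> by (simp add: hom_def)
  note closed = linear_extension_closed[OF Pi] and add = linear_extension_add[OF Pi]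
  fix f g assume "f \<in> carrier (semigroup_algebra S)" "g \<in> carrier (semigroup_algebra S)"
  then have f: "Poly_Mapping.keys f \<subseteq> carrier S" and g: "Poly_Mapping.keys g \<subseteq> carrier S"
    by (simp_all add: semigroup_algebra_simps)
  note mclosed = semigroup_algebra_mult_closed[OF assms(1)]
  show "linear_extension A \<phi> f \<in> carrier A" by (rule closed[OF f])
  show "linear_extension A \<phi> (f \<oplus>\<^bsub>semigroup_algebra S\<^esub> g) =
      linear_extension A \<phi> f \<oplus> linear_extension A \<phi> g"
    by (simp add: semigroup_algebra_simps add f g)
  show "linear_extension A \<phi> (f \<otimes>\<^bsub>semigroup_algebra S\<^esub> g) =
      linear_extension A \<phi> f \<otimes> linear_extension A \<phi> g"
    using f
  proof (induction f rule: poly_mapping_keys_induct)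
    case zero
    then show ?case by (simp add: semigroup_algebra_mult_zero closed[OF g])
  next
    case s: (single s a)
    then have \<phi>s: "\<phi> s \<in> carrier A" using Pi by auto
    show ?case using g
    proof (induction g rule: poly_mapping_keys_induct)
      case zero
      then show ?case using \<phi>s by (simp add: semigroup_algebra_mult_zero linear_extension_single)
    next
      case t: (single t b)
      then have \<phi>t: "\<phi> t \<in> carrier A" using Pi by auto
      have "\<phi> (s \<otimes>\<^bsub>S\<^esub> t) = \<phi> s \<otimes> \<phi> t" using s t \<phi> by (simp add: hom_mult)
      then show ?case using s t \<phi>s \<phi>t
        by (simp add: semigroup_algebra_mult_single linear_extension_single
            smult_mult_l smult_mult_r smult_assoc1[symmetric] mult.commute)
    next
      case (add g g')
      moreover have "Poly_Mapping.keys (Poly_Mapping.single s a) \<subseteq> carrier S" using s by simp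
      ultimately show ?case
        by (simp add: semigroup_algebra_r_distr linear_extension_add[OF Pi] mclosed closed r_distr)
    qed
  next
    case (add f f')
    then show ?case using g
      by (simp add: semigroup_algebra_l_distr linear_extension_add[OF Pi] mclosed closed l_distr)
  qed
next
  show "linear_extension A \<phi> \<one>\<^bsub>semigroup_algebra S\<^esub> = \<one>"
    by (simp add: semigroup_algebra_simps linear_extension_single one)
qed

end

section \<open>Quotient algebras\<close>

lemma quotient_algebra_simps:
  "carrier (quotient_algebra A I) = carrier (A Quot I)"
  "monoid.mult (quotient_algebra A I) = monoid.mult (A Quot I)"
  "\<one>\<^bsub>quotient_algebra A I\<^esub> = \<one>\<^bsub>A Quot I\<^esub>"
  "\<zero>\<^bsub>quotient_algebra A I\<^esub> = \<zero>\<^bsub>A Quot I\<^esub>"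
  "add (quotient_algebra A I) = add (A Quot I)"
  by (simp_all add: quotient_algebra_def)

context complex_alg
begin

text \<open>\<open>A Quot I\<close> is a ring record without scalars, so its axioms are transferred
  one by one to the module record with the same ring operations.\<close>

lemma ring_quotient_algebra:
  assumes "ideal I A"
  shows "ring (quotient_algebra A I)"
proof -
  interpret I: ideal I A by fact
  interpret Q: ring "A Quot I" by (rule I.quotient_is_ring)
  show ?thesis
  proof (rule ringI)
    show "abelian_group (quotient_algebra A I)"
      by (rule abelian_groupI; unfold quotient_algebra_simps; rule Q.a_closed Q.zero_closed
          Q.a_assoc Q.a_comm Q.l_zero Q.add.l_inv_ex; assumption)
    show "Group.monoid (quotient_algebra A I)"
      by (rule monoidI; unfold quotient_algebra_simps; rule Q.m_closed Q.one_closed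
          Q.m_assoc Q.l_one Q.r_one; assumption)
  qed (unfold quotient_algebra_simps, (rule Q.l_distr Q.r_distr; assumption)+)
qed

lemma quotient_algebra_hom:
  assumes "ideal I A"
  shows "(+>) I \<in> ring_hom A (quotient_algebra A I)"
  using ideal.rcos_ring_hom[OF assms]
  by (simp add: ring_hom_def quotient_algebra_simps)

lemma carrier_quotient_algebra:
  "carrier (quotient_algebra A I) = (+>) I ` carrier A"
  unfolding quotient_algebra_simps FactRing_simps partial_object.simps by blast

text \<open>If \<open>y = i \<oplus> x\<close> with \<open>i\<close> in \<open>I\<close>, then
  \<open>c \<odot> y\<close> and \<open>c \<odot> x\<close> differ by \<open>c \<odot> i\<close>,
  again in \<open>I\<close>. So the union in the definition is taken over equal cosets, also for
  \<open>c = 0\<close>.\<close>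

lemma quotient_algebra_smult:
  assumes "ideal I A" "x \<in> carrier A"
  shows "c \<odot>\<^bsub>quotient_algebra A I\<^esub> (I +> x) = I +> (c \<odot> x)"
proof -
  interpret I: ideal I A by fact
  have "I +> (c \<odot> y) = I +> (c \<odot> x)" if y: "y \<in> I +> x" for y
  proof -
    obtain i where i: "i \<in> I" "y = i \<oplus> x"
      using y unfolding a_r_coset_defs by auto
    have "i \<in> carrier A" using i(1) by (rule I.a_Hcarr)
    then have "c \<odot> y = c \<odot> i \<oplus> c \<odot> x" using assms(2) i(2) by (simp add: smult_r_distr)
    then have "c \<odot> y \<in> I +> (c \<odot> x)"
      using smult_ideal[OF assms(1) i(1)] unfolding a_r_coset_defs by auto
    then show ?thesis using assms(2) I.a_repr_independence'[of "c \<odot> y" "c \<odot> x"] by simp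
  qed
  then have "(\<Union>y \<in> I +> x. I +> (c \<odot> y)) = I +> (c \<odot> x)"
    using I.a_rcos_self[OF assms(2)] by (intro UN_constant_eq ballI)
  then show ?thesis by (simp add: quotient_algebra_def)
qed

lemma complex_algebra_quotient_algebra:
  assumes "ideal I A"
  shows "complex_algebra (quotient_algebra A I)"
proof (rule complex_algebraI)
  show "ring (quotient_algebra A I)" by (rule ring_quotient_algebra[OF assms])
next
  let ?Q = "quotient_algebra A I"
  note hom = ring_hom_mult[OF quotient_algebra_hom[OF assms], symmetric]
    ring_hom_add[OF quotient_algebra_hom[OF assms], symmetric]
  note smult = quotient_algebra_smult[OF assms]
  have ex: "\<exists>x \<in> carrier A. U = I +> x" if "U \<in> carrier ?Q" for U
    using that unfolding carrier_quotient_algebra by blast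
  {
    fix c U
    assume "U \<in> carrier ?Q"
    then obtain x where x: "x \<in> carrier A" and U: "U = I +> x" using ex by blast
    show "c \<odot>\<^bsub>?Q\<^esub> U \<in> carrier ?Q"
      unfolding U smult[OF x] carrier_quotient_algebra using x by blast
    show "(c + d) \<odot>\<^bsub>?Q\<^esub> U = c \<odot>\<^bsub>?Q\<^esub> U \<oplus>\<^bsub>?Q\<^esub> d \<odot>\<^bsub>?Q\<^esub> U" for d
      unfolding U using x by (simp add: smult hom smult_l_distr)
    show "(c * d) \<odot>\<^bsub>?Q\<^esub> U = c \<odot>\<^bsub>?Q\<^esub> (d \<odot>\<^bsub>?Q\<^esub> U)" for d
      unfolding U using x by (simp add: smult smult_assoc1)
    show "1 \<odot>\<^bsub>?Q\<^esub> U = U"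
      unfolding U using x by (simp add: smult)
    fix V
    assume "V \<in> carrier ?Q"
    then obtain y where y: "y \<in> carrier A" and V: "V = I +> y" using ex by blast
    show "c \<odot>\<^bsub>?Q\<^esub> (U \<oplus>\<^bsub>?Q\<^esub> V) = c \<odot>\<^bsub>?Q\<^esub> U \<oplus>\<^bsub>?Q\<^esub> c \<odot>\<^bsub>?Q\<^esub> V"
      unfolding U V using x y by (simp add: smult hom smult_r_distr)
    show "(c \<odot>\<^bsub>?Q\<^esub> U) \<otimes>\<^bsub>?Q\<^esub> V = c \<odot>\<^bsub>?Q\<^esub> (U \<otimes>\<^bsub>?Q\<^esub> V)"
      unfolding U V using x y by (simp add: smult hom smult_mult_l)
    show "U \<otimes>\<^bsub>?Q\<^esub> (c \<odot>\<^bsub>?Q\<^esub> V) = c \<odot>\<^bsub>?Q\<^esub> (U \<otimes>\<^bsub>?Q\<^esub> V)"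
      unfolding U V using x y by (simp add: smult hom smult_mult_r)
  }
qed

end

section \<open>Products of commuting families\<close>

text \<open>The usual laws of \<open>finprod\<close> live in commutative monoids. Pairwise
  commutation over a fixed index set \<open>I\<close> already makes the underlying fold independent
  of the order, and the products below run over subsets of \<open>I\<close>.\<close>

locale commuting_family = monoid R for R (structure) +
  fixes I :: "'i set" and e :: "'i \<Rightarrow> 'b"
  assumes fin: "finite I"
    and closed: "i \<in> I \<Longrightarrow> e i \<in> carrier R"
    and comm: "i \<in> I \<Longrightarrow> j \<in> I \<Longrightarrow> e i \<otimes> e j = e j \<otimes> e i"
begin

lemma LCD: "LCD I (carrier R) ((\<otimes>) \<circ> e)"
  by standard (simp_all add: closed comm flip: m_assoc)

lemma prod_empty [simp]: "finprod R e {} = \<one>"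
  by (simp add: finprod_def)

lemma prod_insert:
  "J \<subseteq> I \<Longrightarrow> i \<in> I \<Longrightarrow> i \<notin> J \<Longrightarrow> finprod R e (insert i J) = e i \<otimes> finprod R e J"
  using LCD.foldD_insert[OF LCD, of J i \<one>] finite_subset[OF _ fin, of J]
  by (simp add: finprod_def)

lemma prod_closed [simp]: "J \<subseteq> I \<Longrightarrow> finprod R e J \<in> carrier R"
  using LCD.foldD_closed[OF LCD, of J \<one>] finite_subset[OF _ fin, of J]
  by (simp add: finprod_def)

lemma prod_commute:
  assumes "J \<subseteq> I" "x \<in> carrier R" "\<And>i. i \<in> J \<Longrightarrow> x \<otimes> e i = e i \<otimes> x"
  shows "x \<otimes> finprod R e J = finprod R e J \<otimes> x"
  using finite_subset[OF assms(1) fin] assms(1,3)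
proof (induction J rule: finite_induct)
  case empty
  then show ?case using assms(2) by simp
next
  case (insert i J)
  then have i: "e i \<in> carrier R" and J: "finprod R e J \<in> carrier R"
    and xi: "x \<otimes> e i = e i \<otimes> x" and IH: "x \<otimes> finprod R e J = finprod R e J \<otimes> x"
    using closed by auto
  have "x \<otimes> (e i \<otimes> finprod R e J) = e i \<otimes> (x \<otimes> finprod R e J)"
    using i J assms(2) xi by (simp flip: m_assoc)
  then show ?case using i J assms(2) insert by (simp add: prod_insert IH m_assoc)
qed

text \<open>With \<open>e i\<close> split off as the first factor, idempotence swallows the second
  copy.\<close>

lemma prod_absorb:
  assumes "J \<subseteq> I" "i \<in> J" "e i \<otimes> e i = e i"
  shows "e i \<otimes> finprod R e J = finprod R e J"
proof -
  have "finprod R e J = e i \<otimes> finprod R e (J - {i})"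
    using prod_insert[of "J - {i}" i] assms(1,2) by (auto simp: insert_absorb)
  moreover have "e i \<in> carrier R" "finprod R e (J - {i}) \<in> carrier R"
    using assms(1,2) by (auto intro!: closed prod_closed)
  ultimately show ?thesis using assms(3) by (metis m_assoc)
qed

text \<open>The elements of \<open>K\<close> are added to \<open>J\<close> one at a time: one that
  lies in \<open>J\<close> changes nothing, any other contributes a factor that is absorbed. This is
  the tool for changing index sets in \<open>\<Phi>_one\<close> and
  \<open>\<Phi>_mult\<close>.\<close>

lemma prod_Un_absorb:
  assumes "J \<subseteq> I" "K \<subseteq> I" "\<And>i. i \<in> K \<Longrightarrow> e i \<otimes> finprod R e J = finprod R e J"
  shows "finprod R e (K \<union> J) = finprod R e J"
  using finite_subset[OF assms(2) fin] assms(2,3)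
proof (induction K rule: finite_induct)
  case empty
  then show ?case by simp
next
  case (insert i K)
  show ?case
  proof (cases "i \<in> J")
    case True
    then show ?thesis using insert by (auto simp: insert_absorb)
  next
    case False
    then show ?thesis using insert assms(1) by (simp add: prod_insert)
  qed
qed

end

locale commuting_idempotents = ring R + commuting_family R I e for R (structure) and I e +
  assumes idem: "i \<in> I \<Longrightarrow> e i \<otimes> e i = e i"
begin

abbreviation f where "f i \<equiv> \<one> \<ominus> e i"

lemma f_closed: "i \<in> I \<Longrightarrow> f i \<in> carrier R"
  using closed by simp

lemma e_f_commute: "i \<in> I \<Longrightarrow> j \<in> I \<Longrightarrow> e i \<otimes> f j = f j \<otimes> e i"
  using closed comm[of i j] by (simp add: minus_eq l_distr r_distr l_minus r_minus)

lemma f_commute: "i \<in> I \<Longrightarrow> j \<in> I \<Longrightarrow> f i \<otimes> f j = f j \<otimes> f i"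
  using closed[of i] f_closed[of j] e_f_commute[of i j]
  by (simp add: minus_eq[of \<one> "e i"] l_distr r_distr l_minus r_minus)

text \<open>The complementary idempotents commute pairwise too, which makes every product law above
  available for the second product in [P_B].\<close>

sublocale f: commuting_family R I f
  by standard (use fin f_closed f_commute in auto)

lemma e_prod_f_eq_zero:
  assumes "J \<subseteq> I" "i \<in> J"
  shows "e i \<otimes> finprod R f J = \<zero>"
proof -
  have i: "i \<in> I" using assms by auto
  have "finprod R f J = f i \<otimes> finprod R f (J - {i})"
    using f.prod_insert[of "J - {i}" i] assms by (auto simp: insert_absorb)
  moreover have "e i \<otimes> f i = \<zero>"
    using closed[OF i] idem[OF i] by (simp add: minus_eq r_distr r_minus r_neg)
  moreover have "finprod R f (J - {i}) \<in> carrier R" using assms by (intro f.prod_closed) auto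
  ultimately show ?thesis using closed[OF i] f_closed[OF i]
    by (metis l_null m_assoc)
qed

text \<open>Induction on \<open>C\<close>. A subset of \<open>insert c C\<close> that omits
  \<open>c\<close> leaves an extra factor \<open>f c\<close>, one that contains \<open>c\<close>
  leaves an extra \<open>e c\<close>. The two halves are \<open>f c\<close> and \<open>e c\<close>
  times the smaller sum, and \<open>f c \<oplus> e c\<close> is the unit.\<close>

lemma sum_Pow_prod:
  assumes "A \<subseteq> I" "C \<subseteq> I" "A \<inter> C = {}"
  shows "(\<Oplus>D\<in>Pow C. finprod R e (A \<union> D) \<otimes> finprod R f (C - D)) = finprod R e A"
  using finite_subset[OF assms(2) fin] assms(2,3)
proof (induction C rule: finite_induct)
  case empty
  then show ?case using assms(1) by simp
next
  case (insert c C)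
  define t where "t D = finprod R e (A \<union> D) \<otimes> finprod R f (C - D)" for D
  have t: "t D \<in> carrier R" if "D \<subseteq> C" for D
    unfolding t_def using that insert.prems assms(1) by (intro m_closed prod_closed f.prod_closed) auto
  have c: "c \<in> I" using insert.prems by auto
  have eA: "finprod R e A \<in> carrier R" using assms(1) by simp
  have IH: "(\<Oplus>D\<in>Pow C. t D) = finprod R e A"
    unfolding t_def using insert by auto
  \<comment> \<open>The new factor \<open>f c\<close> stands behind the product of the
    \<open>e\<close>, and is carried to the front past it.\<close>
  have outer: "finprod R e (A \<union> D) \<otimes> finprod R f (insert c C - D) = f c \<otimes> t D" if D: "D \<subseteq> C" for D
  proof -
    have AD: "A \<union> D \<subseteq> I" and CD: "C - D \<subseteq> I" using D insert.prems assms(1) by auto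
    have "insert c C - D = insert c (C - D)" using D insert.hyps by auto
    then have "finprod R f (insert c C - D) = f c \<otimes> finprod R f (C - D)"
      using f.prod_insert[OF CD c] insert.hyps by simp
    moreover have "f c \<otimes> finprod R e (A \<union> D) = finprod R e (A \<union> D) \<otimes> f c"
      using AD c f_closed e_f_commute by (intro prod_commute) auto
    ultimately show ?thesis
      unfolding t_def using AD CD c f_closed by (metis m_assoc prod_closed f.prod_closed)
  qed
  have inner: "finprod R e (A \<union> insert c D) \<otimes> finprod R f (insert c C - insert c D) = e c \<otimes> t D"
    if D: "D \<subseteq> C" for D
  proof -
    have AD: "A \<union> D \<subseteq> I" and CD: "C - D \<subseteq> I" using D insert.prems assms(1) by auto
    have "A \<union> insert c D = insert c (A \<union> D)" "insert c C - insert c D = C - D"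
      "c \<notin> A \<union> D"
      using D insert.hyps insert.prems by auto
    then show ?thesis
      unfolding t_def using AD CD c closed by (simp add: prod_insert m_assoc)
  qed
  let ?g = "\<lambda>D. finprod R e (A \<union> D) \<otimes> finprod R f (insert c C - D)"
  have fC: "finite (Pow C)" using insert.hyps by simp
  have inj: "inj_on (insert c) (Pow C)"
    using insert.hyps by (intro inj_onI) (auto simp: insert_eq_iff)
  have g1: "?g D \<in> carrier R" if "D \<in> Pow C" for D
    using that outer t f_closed[OF c] by simp
  have g2: "?g (insert c D) \<in> carrier R" if "D \<in> Pow C" for D
    using that inner t closed[OF c] by simp
  have "(\<Oplus>D\<in>Pow (insert c C). ?g D) = (\<Oplus>D\<in>Pow C. ?g D) \<oplus> (\<Oplus>D\<in>insert c ` Pow C. ?g D)"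
    unfolding Pow_insert using fC g1 g2 insert.hyps
    by (intro finsum_Un_disjoint) auto
  also have "(\<Oplus>D\<in>Pow C. ?g D) = (\<Oplus>D\<in>Pow C. f c \<otimes> t D)"
    using outer t f_closed[OF c] by (intro finsum_cong') auto
  also have "\<dots> = f c \<otimes> finprod R e A"
    unfolding IH[symmetric] using t f_closed[OF c] fC by (intro finsum_rdistr[symmetric]) auto
  also have "(\<Oplus>D\<in>insert c ` Pow C. ?g D) = (\<Oplus>D\<in>Pow C. ?g (insert c D))"
    using inj g2 by (intro add.finprod_reindex) auto
  also have "\<dots> = (\<Oplus>D\<in>Pow C. e c \<otimes> t D)"
    using inner t closed[OF c] by (intro finsum_cong') auto
  also have "\<dots> = e c \<otimes> finprod R e A"
    unfolding IH[symmetric] using t closed[OF c] fC by (intro finsum_rdistr[symmetric]) auto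
  also have "f c \<otimes> finprod R e A \<oplus> e c \<otimes> finprod R e A = (f c \<oplus> e c) \<otimes> finprod R e A"
    using closed[OF c] f_closed[OF c] eA by (simp add: l_distr)
  also have "f c \<oplus> e c = \<one>"
    using closed[OF c] by (simp add: minus_eq a_assoc l_neg)
  finally show ?case using eA by simp
qed

lemma sum_supsets_prod:
  assumes "A \<subseteq> I"
  shows "(\<Oplus>B\<in>{B. A \<subseteq> B \<and> B \<subseteq> I}. finprod R e B \<otimes> finprod R f (I - B)) = finprod R e A"
proof -
  \<comment> \<open>A superset of \<open>A\<close> is determined by the part \<open>D\<close> that
    it adds outside \<open>A\<close>, which matches the index set of
    \<open>sum_Pow_prod\<close>.\<close>
  have *: "{B. A \<subseteq> B \<and> B \<subseteq> I} = (\<union>) A ` Pow (I - A)"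
  proof (intro equalityI subsetI)
    fix B assume "B \<in> {B. A \<subseteq> B \<and> B \<subseteq> I}"
    then show "B \<in> (\<union>) A ` Pow (I - A)" by (intro image_eqI[of _ _ "B - A"]) auto
  qed (use assms in auto)
  have "inj_on ((\<union>) A) (Pow (I - A))"
    by (intro inj_onI) blast
  then have "(\<Oplus>B\<in>{B. A \<subseteq> B \<and> B \<subseteq> I}. finprod R e B \<otimes> finprod R f (I - B)) =
      (\<Oplus>D\<in>Pow (I - A). finprod R e (A \<union> D) \<otimes> finprod R f (I - (A \<union> D)))"
    unfolding * using assms
    by (intro add.finprod_reindex) (auto intro!: m_closed prod_closed f.prod_closed)
  also have "(\<lambda>D. I - (A \<union> D)) = (\<lambda>D. I - A - D)" by blast
  also have "(\<Oplus>D\<in>Pow (I - A). finprod R e (A \<union> D) \<otimes> finprod R f (I - A - D)) = finprod R e A"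
    using sum_Pow_prod[of A "I - A"] assms by simp
  finally show ?thesis .
qed

end

section \<open>Partial representations\<close>

text \<open>Left cosets that meet coincide, so in a union of cosets the coset of each point is one
  of those united. The pointwise form is the convenient one for membership proofs.\<close>

lemma (in group) P_H_iff:
  assumes "subgroup H G"
  shows "A \<in> P_H G H \<longleftrightarrow> A \<subseteq> carrier G \<and> H \<subseteq> A \<and> (\<forall>x\<in>A. x <#\<^bsub>G\<^esub> H \<subseteq> A)"
proof
  assume A: "A \<in> P_H G H"
  then obtain C where C: "C \<subseteq> lcosets H" "A = \<Union>C" and sub: "A \<subseteq> carrier G" "H \<subseteq> A"
    by (auto simp: P_H_def)
  have "x <#\<^bsub>G\<^esub> H \<subseteq> A" if x: "x \<in> A" for x
  proof -
    obtain y where y: "y \<in> carrier G" "x \<in> y <#\<^bsub>G\<^esub> H" "y <#\<^bsub>G\<^esub> H \<in> C"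
      using x C by (auto simp: LCOSETS_def)
    then have "x <#\<^bsub>G\<^esub> H = y <#\<^bsub>G\<^esub> H" using l_repr_independence[OF y(2,1) assms] by simp
    then show ?thesis using y(3) C(2) by auto
  qed
  then show "A \<subseteq> carrier G \<and> H \<subseteq> A \<and> (\<forall>x\<in>A. x <#\<^bsub>G\<^esub> H \<subseteq> A)" using sub by blast
next
  assume A: "A \<subseteq> carrier G \<and> H \<subseteq> A \<and> (\<forall>x\<in>A. x <#\<^bsub>G\<^esub> H \<subseteq> A)"
  then have "A = \<Union>((\<lambda>x. x <#\<^bsub>G\<^esub> H) ` A)"
    using lcos_self[OF _ assms] by blast
  moreover have "(\<lambda>x. x <#\<^bsub>G\<^esub> H) ` A \<subseteq> lcosets H" using A by (auto simp: LCOSETS_def)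
  ultimately show "A \<in> P_H G H" using A by (auto simp: P_H_def)
qed

text \<open>The generators without the presentation: \<open>p\<close> satisfies the defining
  relations in some ring. The identities for e_g, [P_B] and the images of the symbols follow from
  these equations alone; scalars come in with the linear extension. \<open>p_one\<close> identifies
  [1] with the unit of \<open>R\<close>.\<close>

locale partial_rep = G: group G + R: ring R for G (structure) and R (structure) +
  fixes H and p
  assumes finite_G: "finite (carrier G)"
    and subgroup: "subgroup H G"
    and p_closed: "g \<in> carrier G \<Longrightarrow> p g \<in> carrier R"
    and p_one: "p \<one>\<^bsub>G\<^esub> = \<one>\<^bsub>R\<^esub>"
    and p_left: "g \<in> carrier G \<Longrightarrow> g' \<in> carrier G \<Longrightarrow>
      p (inv\<^bsub>G\<^esub> g) \<otimes>\<^bsub>R\<^esub> p g \<otimes>\<^bsub>R\<^esub> p g' = p (inv\<^bsub>G\<^esub> g) \<otimes>\<^bsub>R\<^esub> p (g \<otimes>\<^bsub>G\<^esub> g')"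
    and p_right: "g \<in> carrier G \<Longrightarrow> g' \<in> carrier G \<Longrightarrow>
      p g' \<otimes>\<^bsub>R\<^esub> p g \<otimes>\<^bsub>R\<^esub> p (inv\<^bsub>G\<^esub> g) = p (g' \<otimes>\<^bsub>G\<^esub> g) \<otimes>\<^bsub>R\<^esub> p (inv\<^bsub>G\<^esub> g)"
    and p_H: "h \<in> H \<Longrightarrow> p h \<otimes>\<^bsub>R\<^esub> p (inv\<^bsub>G\<^esub> h) = \<one>\<^bsub>R\<^esub>"
begin

section \<open>The commuting idempotents of a partial representation\<close>

definition e where "e g = p g \<otimes>\<^bsub>R\<^esub> p (inv\<^bsub>G\<^esub> g)"

lemma e_closed: "g \<in> carrier G \<Longrightarrow> e g \<in> carrier R"
  by (simp add: e_def p_closed)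

text \<open>The right relation contracts the first two of the three factors \<open>p g\<close>,
  \<open>p (inv g)\<close>, \<open>p g\<close> to \<open>p \<one>\<close>.\<close>

lemma p_e_inv: "g \<in> carrier G \<Longrightarrow> p g \<otimes>\<^bsub>R\<^esub> e (inv\<^bsub>G\<^esub> g) = p g"
  using p_right[of "inv\<^bsub>G\<^esub> g" g] by (simp add: e_def p_closed p_one flip: R.m_assoc)

text \<open>Moving \<open>p g\<close> past an idempotent translates its index by \<open>g\<close>;
  this rule drives commutation and coset invariance. The right relation merges \<open>p g\<close>
  and \<open>p x\<close> in front of \<open>p (inv x)\<close>; the left relation, read backwards,
  then creates the missing factor at the inverse of \<open>g \<otimes> x\<close>.\<close>

lemma p_e:
  assumes [simp]: "g \<in> carrier G" "x \<in> carrier G"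
  shows "p g \<otimes>\<^bsub>R\<^esub> e x = e (g \<otimes>\<^bsub>G\<^esub> x) \<otimes>\<^bsub>R\<^esub> p g"
proof -
  have "p g \<otimes>\<^bsub>R\<^esub> e x = p (g \<otimes>\<^bsub>G\<^esub> x) \<otimes>\<^bsub>R\<^esub> p (inv\<^bsub>G\<^esub> x)"
    using p_right[of x g] by (simp add: e_def p_closed R.m_assoc)
  also have "\<dots> = p (g \<otimes>\<^bsub>G\<^esub> x) \<otimes>\<^bsub>R\<^esub> p (inv\<^bsub>G\<^esub> (g \<otimes>\<^bsub>G\<^esub> x)) \<otimes>\<^bsub>R\<^esub> p g"
    using p_left[of "inv\<^bsub>G\<^esub> (g \<otimes>\<^bsub>G\<^esub> x)" g] by (simp add: G.inv_mult_group G.m_assoc)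
  finally show ?thesis by (simp add: e_def)
qed

lemma e_idem: "g \<in> carrier G \<Longrightarrow> e g \<otimes>\<^bsub>R\<^esub> e g = e g"
  using p_e_inv[of "inv\<^bsub>G\<^esub> g"] e_closed[of g] p_closed by (simp add: e_def R.m_assoc)

text \<open>\<open>e y\<close> travels left past \<open>p (inv x)\<close>, becoming the idempotent
  at x^-1 y, and then past \<open>p x\<close>, which turns it back into \<open>e y\<close>.\<close>

lemma e_commute:
  assumes [simp]: "x \<in> carrier G" "y \<in> carrier G"
  shows "e x \<otimes>\<^bsub>R\<^esub> e y = e y \<otimes>\<^bsub>R\<^esub> e x"
proof -
  have "e x \<otimes>\<^bsub>R\<^esub> e y = p x \<otimes>\<^bsub>R\<^esub> e (inv\<^bsub>G\<^esub> x \<otimes>\<^bsub>G\<^esub> y) \<otimes>\<^bsub>R\<^esub> p (inv\<^bsub>G\<^esub> x)"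
    using p_e[of "inv\<^bsub>G\<^esub> x" y] by (simp add: e_def[of x] p_closed e_closed R.m_assoc)
  also have "\<dots> = e y \<otimes>\<^bsub>R\<^esub> e x"
    using p_e[of x "inv\<^bsub>G\<^esub> x \<otimes>\<^bsub>G\<^esub> y"]
    by (simp add: e_def[of x] p_closed e_closed R.m_assoc flip: G.m_assoc)
  finally show ?thesis .
qed

section \<open>Invariance of the idempotents along left cosets of H\<close>

lemma H_carrier [simp]: "h \<in> H \<Longrightarrow> h \<in> carrier G"
  using subgroup by (rule subgroup.mem_carrier)

text \<open>\<open>p_H\<close> says that \<open>e h\<close> is the unit; moved past
  \<open>p x\<close>, this trivial factor becomes \<open>e (x \<otimes> h)\<close>.\<close>

lemma e_absorb_coset:
  assumes x: "x \<in> carrier G" and h: "h \<in> H"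
  shows "e (x \<otimes>\<^bsub>G\<^esub> h) \<otimes>\<^bsub>R\<^esub> e x = e x"
proof -
  have "e h = \<one>\<^bsub>R\<^esub>" using p_H[OF h] by (simp add: e_def)
  then have "p x = e (x \<otimes>\<^bsub>G\<^esub> h) \<otimes>\<^bsub>R\<^esub> p x"
    using p_e[of x h] x h p_closed by simp
  then show ?thesis
    using x h p_closed e_closed by (simp add: e_def[of x] flip: R.m_assoc)
qed

text \<open>Absorption holds from \<open>x\<close> to \<open>x \<otimes> h\<close> and, via
  \<open>inv h\<close>, back again. Commuting elements that absorb each other are equal.\<close>

lemma e_coset:
  assumes x: "x \<in> carrier G" and h: "h \<in> H"
  shows "e (x \<otimes>\<^bsub>G\<^esub> h) = e x"
  using e_absorb_coset[OF assms] e_absorb_coset[of "x \<otimes>\<^bsub>G\<^esub> h" "inv\<^bsub>G\<^esub> h"]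
    e_commute[of "x \<otimes>\<^bsub>G\<^esub> h" x] assms subgroup.m_inv_closed[OF subgroup h]
  by (simp add: G.m_assoc)

section \<open>The elements [P_B] and their sums over supersets\<close>

sublocale commuting_idempotents R "carrier G" e
  by standard (use finite_G e_closed e_commute e_idem in auto)

abbreviation P where
  "P B \<equiv> finprod R e B \<otimes>\<^bsub>R\<^esub> finprod R (\<lambda>g. \<one>\<^bsub>R\<^esub> \<ominus>\<^bsub>R\<^esub> e g) (carrier G - B)"

lemma P_closed: "B \<subseteq> carrier G \<Longrightarrow> P B \<in> carrier R"
  by (intro R.m_closed prod_closed f.prod_closed) auto

text \<open>For a suitable \<open>y\<close> outside \<open>B\<close>, inserting \<open>e y\<close>
  between the two products leaves \<open>P B\<close> unchanged, while \<open>e y\<close> annihilates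
  the factor \<open>\<one> \<ominus> e y\<close> of the second one.\<close>

lemma P_eq_zero:
  assumes B: "B \<subseteq> carrier G" and "B \<notin> P_H G H"
  shows "P B = \<zero>\<^bsub>R\<^esub>"
proof -
  \<comment> \<open>a point outside \<open>B\<close> whose idempotent is absorbed by the product over \<open>B\<close>\<close>
  obtain y where y: "y \<in> carrier G - B" "e y \<otimes>\<^bsub>R\<^esub> finprod R e B = finprod R e B"
  proof (cases "H \<subseteq> B")
    case False
    then obtain h where h: "h \<in> H" "h \<notin> B" by auto
    then have "e h = \<one>\<^bsub>R\<^esub>" using p_H by (simp add: e_def)
    then show ?thesis using that[of h] h B by simp
  next
    case True
    then obtain x z where x: "x \<in> B" "z \<in> x <#\<^bsub>G\<^esub> H" "z \<notin> B"
      using assms G.P_H_iff[OF subgroup] by auto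
    then obtain h where h: "h \<in> H" "z = x \<otimes>\<^bsub>G\<^esub> h" by (auto simp: l_coset_def)
    have "e z = e x" using h x B by (auto intro: e_coset)
    then show ?thesis using that[of z] prod_absorb[OF B x(1)] e_idem x h B by auto
  qed
  have "e y \<otimes>\<^bsub>R\<^esub> finprod R (\<lambda>g. \<one>\<^bsub>R\<^esub> \<ominus>\<^bsub>R\<^esub> e g) (carrier G - B) = \<zero>\<^bsub>R\<^esub>"
    using y(1) by (intro e_prod_f_eq_zero) auto
  moreover have *: "e y \<otimes>\<^bsub>R\<^esub> finprod R e B = finprod R e B \<otimes>\<^bsub>R\<^esub> e y"
    using y(1) B e_closed e_commute by (intro prod_commute) auto
  ultimately have "finprod R e B \<otimes>\<^bsub>R\<^esub> e y \<otimes>\<^bsub>R\<^esub>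
      finprod R (\<lambda>g. \<one>\<^bsub>R\<^esub> \<ominus>\<^bsub>R\<^esub> e g) (carrier G - B) = \<zero>\<^bsub>R\<^esub>"
    using y(1) B e_closed by (simp add: R.m_assoc)
  then show ?thesis using y(2) * by simp
qed

lemma sum_P:
  assumes "A \<in> P_H G H"
  shows "(\<Oplus>\<^bsub>R\<^esub>B\<in>{B \<in> P_H G H. A \<subseteq> B}. P B) = finprod R e A"
proof -
  have A: "A \<subseteq> carrier G" using assms by (simp add: P_H_def)
  have "(\<Oplus>\<^bsub>R\<^esub>B\<in>{B \<in> P_H G H. A \<subseteq> B}. P B) =
      (\<Oplus>\<^bsub>R\<^esub>B\<in>{B. A \<subseteq> B \<and> B \<subseteq> carrier G}. P B)"
  proof (rule R.add.finprod_mono_neutral_cong_left)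
    show "finite {B. A \<subseteq> B \<and> B \<subseteq> carrier G}" using finite_G by simp
    show "{B \<in> P_H G H. A \<subseteq> B} \<subseteq> {B. A \<subseteq> B \<and> B \<subseteq> carrier G}" by (auto simp: P_H_def)
  qed (use P_closed P_eq_zero in auto)
  also have "\<dots> = finprod R e A" by (rule sum_supsets_prod[OF A])
  finally show ?thesis .
qed

section \<open>The map of the theorem on symbols, for an arbitrary partial representation\<close>

definition \<Phi> where
  "\<Phi> = (\<lambda>(A, g). \<Oplus>\<^bsub>R\<^esub>B\<in>{B \<in> P_H G H. A \<subseteq> B}. p g \<otimes>\<^bsub>R\<^esub> P B)"

text \<open>\<open>p g\<close> is pulled out of the sum, and \<open>sum_P\<close> collapses what is
  left to a single product.\<close>

lemma \<Phi>_eq: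
  assumes "A \<in> P_H G H" "g \<in> carrier G"
  shows "\<Phi> (A, g) = p g \<otimes>\<^bsub>R\<^esub> finprod R e A"
proof -
  have sub: "{B \<in> P_H G H. A \<subseteq> B} \<subseteq> Pow (carrier G)" by (auto simp: P_H_def)
  then have "finite {B \<in> P_H G H. A \<subseteq> B}" using finite_G by (simp add: finite_subset)
  moreover have "P \<in> {B \<in> P_H G H. A \<subseteq> B} \<rightarrow> carrier R"
    using sub by (intro Pi_I P_closed) auto
  ultimately show ?thesis
    unfolding sum_P[OF assms(1), symmetric] \<Phi>_def
    using p_closed[OF assms(2)] by (simp add: R.finsum_rdistr)
qed

lemma \<Phi>_closed: "x \<in> carrier (S_H G H) \<Longrightarrow> \<Phi> x \<in> carrier R"
  by (cases x) (auto simp: S_H_def \<Phi>_eq p_closed P_H_def intro!: R.m_closed prod_closed)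

text \<open>Every factor \<open>e h\<close> with \<open>h\<close> in \<open>H\<close> equals one, so
  the product over \<open>H\<close> agrees with the empty product.\<close>

lemma \<Phi>_one: "\<Phi> (H, \<one>\<^bsub>G\<^esub>) = \<one>\<^bsub>R\<^esub>"
proof -
  have "H \<in> P_H G H"
    using subgroup by (auto simp: G.P_H_iff l_coset_def subgroup.m_closed)
  moreover have "finprod R e (H \<union> {}) = finprod R e {}"
    using p_H by (intro prod_Un_absorb) (auto simp: e_def)
  ultimately show ?thesis by (simp add: \<Phi>_eq p_one)
qed

text \<open>The argument on the left is s_g times (B, h), multiplied out; its first component is
  h^-1 H \<union> (gh)^-1 H \<union> B. By coset invariance the added factors are the idempotents at
  h^-1, which \<open>B\<close> already provides, and at (gh)^-1, which
  \<open>p (g \<otimes> h)\<close> absorbs. It remains to compare \<open>p (g \<otimes> h)\<close>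
  with the product of \<open>p g\<close> and \<open>p h\<close> in front of the product over
  \<open>B\<close>.\<close>

lemma \<Phi>_mult:
  assumes g: "g \<in> carrier G" and Bh: "B \<in> P_H G H" "h \<in> carrier G" "inv\<^bsub>G\<^esub> h \<in> B"
    and A: "(inv\<^bsub>G\<^esub> h <#\<^bsub>G\<^esub> (H \<union> (inv\<^bsub>G\<^esub> g <#\<^bsub>G\<^esub> H))) \<union> B \<in> P_H G H"
  shows "\<Phi> ((inv\<^bsub>G\<^esub> h <#\<^bsub>G\<^esub> (H \<union> (inv\<^bsub>G\<^esub> g <#\<^bsub>G\<^esub> H))) \<union> B, g \<otimes>\<^bsub>G\<^esub> h) = p g \<otimes>\<^bsub>R\<^esub> \<Phi> (B, h)"
proof -
  let ?k = "inv\<^bsub>G\<^esub> (g \<otimes>\<^bsub>G\<^esub> h)" and ?X = "inv\<^bsub>G\<^esub> h <#\<^bsub>G\<^esub> (H \<union> (inv\<^bsub>G\<^esub> g <#\<^bsub>G\<^esub> H))"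
  have B: "B \<subseteq> carrier G" using Bh by (simp add: P_H_def)
  have EB: "finprod R e B \<in> carrier R" using B by simp
  have kB: "insert ?k B \<subseteq> carrier G" using B g Bh by auto
  have X: "?X \<subseteq> carrier G" using A by (simp add: P_H_def)
  have ab: "e y \<otimes>\<^bsub>R\<^esub> finprod R e (insert ?k B) = finprod R e (insert ?k B)"
    if "y \<in> insert ?k B" for y
    using that kB by (intro prod_absorb e_idem) auto
  have "e x \<otimes>\<^bsub>R\<^esub> finprod R e (insert ?k B) = finprod R e (insert ?k B)" if "x \<in> ?X" for x
  proof -
    have "(\<exists>c\<in>H. x = inv\<^bsub>G\<^esub> h \<otimes>\<^bsub>G\<^esub> c) \<or> (\<exists>c\<in>H. x = ?k \<otimes>\<^bsub>G\<^esub> c)"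
      using that g Bh by (auto simp: l_coset_def G.inv_mult_group G.m_assoc)
    then have "e x = e (inv\<^bsub>G\<^esub> h) \<or> e x = e ?k"
      using g Bh by (auto simp: e_coset)
    then show ?thesis using ab[of "inv\<^bsub>G\<^esub> h"] ab[of ?k] Bh by auto
  qed
  then have E1: "finprod R e (?X \<union> insert ?k B) = finprod R e (insert ?k B)"
    using X kB by (intro prod_Un_absorb) auto
  \<comment> \<open>As \<open>?k\<close> already belongs to \<open>?X\<close>, inserting it into
    \<open>B\<close> does not alter the union; it was inserted so that the product over
    \<open>insert ?k B\<close> absorbs all of \<open>?X\<close>.\<close>
  have "?k \<in> ?X"
  proof -
    have "inv\<^bsub>G\<^esub> g \<in> inv\<^bsub>G\<^esub> g <#\<^bsub>G\<^esub> H" using g subgroup by (intro G.lcos_self) auto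
    then show ?thesis using g Bh by (auto simp: l_coset_def G.inv_mult_group)
  qed
  then have E2: "?X \<union> insert ?k B = ?X \<union> B" by auto
  have E3: "finprod R e (insert ?k B) = e ?k \<otimes>\<^bsub>R\<^esub> finprod R e B"
  proof (cases "?k \<in> B")
    case True
    then show ?thesis using ab[OF insertI1] by (simp add: insert_absorb)
  next
    case False
    then show ?thesis using kB by (simp add: prod_insert)
  qed
  have pe: "p (g \<otimes>\<^bsub>G\<^esub> h) \<otimes>\<^bsub>R\<^esub> e ?k = p (g \<otimes>\<^bsub>G\<^esub> h)"
    using p_e_inv[of "g \<otimes>\<^bsub>G\<^esub> h"] g Bh by simp
  have "\<Phi> (?X \<union> B, g \<otimes>\<^bsub>G\<^esub> h) = p (g \<otimes>\<^bsub>G\<^esub> h) \<otimes>\<^bsub>R\<^esub> finprod R e (?X \<union> B)"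
    using A g Bh by (intro \<Phi>_eq) auto
  also have "\<dots> = p (g \<otimes>\<^bsub>G\<^esub> h) \<otimes>\<^bsub>R\<^esub> (e ?k \<otimes>\<^bsub>R\<^esub> finprod R e B)"
    using E1 E2 E3 by simp
  also have "\<dots> = p (g \<otimes>\<^bsub>G\<^esub> h) \<otimes>\<^bsub>R\<^esub> finprod R e B"
    using EB pe g Bh p_closed e_closed by (simp flip: R.m_assoc)
  finally have L: "\<Phi> (?X \<union> B, g \<otimes>\<^bsub>G\<^esub> h) = p (g \<otimes>\<^bsub>G\<^esub> h) \<otimes>\<^bsub>R\<^esub> finprod R e B" .
  \<comment> \<open>since \<open>h\<^sup>-\<^sup>1 \<in> B\<close>, the factor \<open>p h\<close> may be replaced by \<open>p h \<cdot> p h\<^sup>-\<^sup>1 \<cdot> p h\<close>, which makes \<open>p\<close> multiplicative here\<close>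
  have e: "e (inv\<^bsub>G\<^esub> h) \<otimes>\<^bsub>R\<^esub> finprod R e B = finprod R e B"
    using B Bh by (intro prod_absorb e_idem) auto
  have "p g \<otimes>\<^bsub>R\<^esub> p h \<otimes>\<^bsub>R\<^esub> e (inv\<^bsub>G\<^esub> h) = p (g \<otimes>\<^bsub>G\<^esub> h) \<otimes>\<^bsub>R\<^esub> e (inv\<^bsub>G\<^esub> h)"
    using p_right[of h g] g Bh p_closed by (simp add: e_def flip: R.m_assoc)
  then have "p g \<otimes>\<^bsub>R\<^esub> p h \<otimes>\<^bsub>R\<^esub> (e (inv\<^bsub>G\<^esub> h) \<otimes>\<^bsub>R\<^esub> finprod R e B) =
      p (g \<otimes>\<^bsub>G\<^esub> h) \<otimes>\<^bsub>R\<^esub> (e (inv\<^bsub>G\<^esub> h) \<otimes>\<^bsub>R\<^esub> finprod R e B)"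
    using g Bh EB p_closed e_closed by (simp flip: R.m_assoc)
  then show ?thesis
    unfolding L e using g Bh EB p_closed by (simp add: \<Phi>_eq R.m_assoc)
qed

end

section \<open>The inverse semigroup\<close>

locale group_subgroup = group G for G (structure) +
  fixes H
  assumes subgroup: "subgroup H G"
begin

abbreviation S where "S \<equiv> S_H G H"

section \<open>The sets in P_H(G/H) under left translation\<close>

lemma l_coset_Un: "x <#\<^bsub>G\<^esub> (A \<union> B) = (x <#\<^bsub>G\<^esub> A) \<union> (x <#\<^bsub>G\<^esub> B)"
  by (auto simp: l_coset_def)

lemma H_subset [simp]: "H \<subseteq> carrier G"
  by (rule subgroup.subset[OF subgroup])

lemma P_H_subset: "A \<in> P_H G H \<Longrightarrow> A \<subseteq> carrier G"
  by (simp add: P_H_def)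

lemma P_H_coset: "A \<in> P_H G H \<Longrightarrow> x \<in> A \<Longrightarrow> x <#\<^bsub>G\<^esub> H \<subseteq> A"
  by (simp add: P_H_iff[OF subgroup])

lemma P_H_one: "A \<in> P_H G H \<Longrightarrow> \<one> \<in> A"
  using subgroup.one_closed[OF subgroup] by (auto simp: P_H_def)

lemma l_coset_H_closed:
  assumes "x \<in> carrier G" "y \<in> x <#\<^bsub>G\<^esub> H"
  shows "y <#\<^bsub>G\<^esub> H \<subseteq> x <#\<^bsub>G\<^esub> H"
  using l_repr_independence[OF assms(2,1) subgroup] by simp

lemma H_P_H: "H \<in> P_H G H"
  using l_coset_H_closed[of \<one>] by (simp add: P_H_iff[OF subgroup] lcos_mult_one)

text \<open>Left translation preserves saturation under \<open>H\<close> on the right, since (xa)H =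
  x(aH). The translate of \<open>A\<close> may miss \<open>H\<close>; the union with
  \<open>B\<close> restores it.\<close>

lemma P_H_l_coset_Un:
  assumes A: "A \<in> P_H G H" and B: "B \<in> P_H G H" and x: "x \<in> carrier G"
  shows "(x <#\<^bsub>G\<^esub> A) \<union> B \<in> P_H G H"
proof -
  note sub = P_H_subset[OF A] P_H_subset[OF B]
  have "y <#\<^bsub>G\<^esub> H \<subseteq> x <#\<^bsub>G\<^esub> A" if y: "y \<in> x <#\<^bsub>G\<^esub> A" for y
  proof -
    obtain a where a: "a \<in> A" "y = x \<otimes> a" using y by (auto simp: l_coset_def)
    then have "y <#\<^bsub>G\<^esub> H = x <#\<^bsub>G\<^esub> (a <#\<^bsub>G\<^esub> H)"
      using x sub by (auto simp: lcos_m_assoc)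
    then show ?thesis using P_H_coset[OF A a(1)] by (auto simp: l_coset_def)
  qed
  then show ?thesis
    using P_H_coset[OF B] l_coset_subset_G[OF sub(1) x] B sub
    by (auto simp: P_H_iff[OF subgroup])
qed

lemma coset_P_H: "x \<in> carrier G \<Longrightarrow> H \<union> (x <#\<^bsub>G\<^esub> H) \<in> P_H G H"
  using P_H_l_coset_Un[OF H_P_H H_P_H] by (simp add: Un_commute)

section \<open>The monoid of symbols and its inverses\<close>

lemma S_mult: "(A, g) \<otimes>\<^bsub>S\<^esub> (B, h) = ((inv h <#\<^bsub>G\<^esub> A) \<union> B, g \<otimes> h)"
  by (simp add: S_H_def)

lemma S_one: "\<one>\<^bsub>S\<^esub> = (H, \<one>)"
  by (simp add: S_H_def)

lemma S_carrier: "(A, g) \<in> carrier S \<longleftrightarrow> A \<in> P_H G H \<and> g \<in> carrier G \<and> inv g \<in> A"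
  by (simp add: S_H_def)

lemma S_closed:
  assumes "x \<in> carrier S" "y \<in> carrier S"
  shows "x \<otimes>\<^bsub>S\<^esub> y \<in> carrier S"
proof -
  obtain A g B h where xy: "x = (A, g)" "y = (B, h)" by (cases x, cases y)
  have *: "A \<in> P_H G H" "g \<in> carrier G" "inv g \<in> A" "B \<in> P_H G H" "h \<in> carrier G" "inv h \<in> B"
    using assms by (simp_all add: xy S_carrier)
  then have "inv h \<otimes> inv g \<in> inv h <#\<^bsub>G\<^esub> A" by (auto simp: l_coset_def)
  then show ?thesis using * by (simp add: xy S_mult S_carrier P_H_l_coset_Un inv_mult_group)
qed

lemma S_monoid: "monoid S"
proof (rule monoidI)
  show "\<one>\<^bsub>S\<^esub> \<in> carrier S"
    using subgroup.one_closed[OF subgroup] by (simp add: S_one S_carrier H_P_H)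
next
  fix x y z assume xyz: "x \<in> carrier S" "y \<in> carrier S" "z \<in> carrier S"
  obtain A g B h C k where eq: "x = (A, g)" "y = (B, h)" "z = (C, k)"
    by (cases x, cases y, cases z)
  then show "x \<otimes>\<^bsub>S\<^esub> y \<otimes>\<^bsub>S\<^esub> z = x \<otimes>\<^bsub>S\<^esub> (y \<otimes>\<^bsub>S\<^esub> z)"
    using xyz by (simp add: S_mult S_carrier l_coset_Un lcos_m_assoc P_H_subset inv_mult_group
        m_assoc Un_assoc)
next
  fix x assume x: "x \<in> carrier S"
  obtain A g where eq: "x = (A, g)" by (cases x)
  have A: "A \<in> P_H G H" "g \<in> carrier G" "inv g \<in> A" using x by (simp_all add: eq S_carrier)
  \<comment> \<open>The condition g^-1 \<in> A is what makes (H, 1) a left identity: it puts g^-1 H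
    inside A.\<close>
  then have "(inv g <#\<^bsub>G\<^esub> H) \<union> A = A" "A \<union> H = A"
    using P_H_coset[OF A(1,3)] by (auto simp: P_H_def)
  then show "\<one>\<^bsub>S\<^esub> \<otimes>\<^bsub>S\<^esub> x = x" "x \<otimes>\<^bsub>S\<^esub> \<one>\<^bsub>S\<^esub> = x"
    using A by (simp_all add: eq S_one S_mult lcos_mult_one P_H_subset)
qed (rule S_closed)

text \<open>The inverse of x = (A, g) is (gA, g^-1). For uniqueness, let y = (B, h): xyx = x gives h
  = g^-1 and g^-1 B \<subseteq> A, while yxy = y gives gA \<subseteq> B, so B = gA.\<close>

lemma inverse_semigroup_S: "inverse_semigroup S"
  unfolding inverse_semigroup_def
proof (intro conjI ballI)
  fix x assume x: "x \<in> carrier S"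
  obtain A g where eq: "x = (A, g)" by (cases x)
  have A: "A \<in> P_H G H" "g \<in> carrier G" "inv g \<in> A" using x by (simp_all add: eq S_carrier)
  note sub = P_H_subset[OF A(1)]
  have sub': "inv g <#\<^bsub>G\<^esub> T \<subseteq> carrier G" "g <#\<^bsub>G\<^esub> T \<subseteq> carrier G" if "T \<subseteq> carrier G" for T
    using that A by (simp_all add: l_coset_subset_G)
  have cancel: "inv g <#\<^bsub>G\<^esub> (g <#\<^bsub>G\<^esub> T) = T" "g <#\<^bsub>G\<^esub> (inv g <#\<^bsub>G\<^esub> T) = T" if "T \<subseteq> carrier G" for T
    using that A by (simp_all add: lcos_m_assoc lcos_mult_one)
  \<comment> \<open>The translate gA contains H because g^-1 H lies in A; hence gA is itself in
    P_H(G/H).\<close>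
  have "H = g <#\<^bsub>G\<^esub> (inv g <#\<^bsub>G\<^esub> H)" by (simp add: cancel)
  also have "\<dots> \<subseteq> g <#\<^bsub>G\<^esub> A"
    using P_H_coset[OF A(1,3)] by (auto simp: l_coset_def)
  finally have "(g <#\<^bsub>G\<^esub> A) \<union> H = g <#\<^bsub>G\<^esub> A" by blast
  then have gA: "g <#\<^bsub>G\<^esub> A \<in> P_H G H" using P_H_l_coset_Un[OF A(1) H_P_H A(2)] by simp
  have "g \<otimes> \<one> \<in> g <#\<^bsub>G\<^esub> A" using P_H_one[OF A(1)] by (auto simp: l_coset_def)
  then have y: "(g <#\<^bsub>G\<^esub> A, inv g) \<in> carrier S" using A gA by (simp add: S_carrier)
  show "\<exists>!y. y \<in> carrier S \<and> x \<otimes>\<^bsub>S\<^esub> y \<otimes>\<^bsub>S\<^esub> x = x \<and> y \<otimes>\<^bsub>S\<^esub> x \<otimes>\<^bsub>S\<^esub> y = y"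
  proof (rule ex1I[of _ "(g <#\<^bsub>G\<^esub> A, inv g)"], intro conjI)
    show "x \<otimes>\<^bsub>S\<^esub> (g <#\<^bsub>G\<^esub> A, inv g) \<otimes>\<^bsub>S\<^esub> x = x"
      "(g <#\<^bsub>G\<^esub> A, inv g) \<otimes>\<^bsub>S\<^esub> x \<otimes>\<^bsub>S\<^esub> (g <#\<^bsub>G\<^esub> A, inv g) = (g <#\<^bsub>G\<^esub> A, inv g)"
      using A sub by (simp_all add: eq S_mult l_coset_Un cancel)
  next
    fix y assume y: "y \<in> carrier S \<and> x \<otimes>\<^bsub>S\<^esub> y \<otimes>\<^bsub>S\<^esub> x = x \<and> y \<otimes>\<^bsub>S\<^esub> x \<otimes>\<^bsub>S\<^esub> y = y"
    obtain B h where yeq: "y = (B, h)" by (cases y)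
    have B: "B \<in> P_H G H" "h \<in> carrier G" using y by (simp_all add: yeq S_carrier)
    note subB = P_H_subset[OF B(1)]
    have 1: "(inv g <#\<^bsub>G\<^esub> ((inv h <#\<^bsub>G\<^esub> A) \<union> B)) \<union> A = A" "g \<otimes> h \<otimes> g = g"
      and 2: "(inv h <#\<^bsub>G\<^esub> ((inv g <#\<^bsub>G\<^esub> B) \<union> A)) \<union> B = B"
      using y by (simp_all add: eq yeq S_mult)
    have "h \<otimes> g = \<one>" using 1(2) A B by (simp add: m_assoc)
    then have h: "h = inv g" using A B by (simp add: inv_equality)
    have "inv g <#\<^bsub>G\<^esub> B \<subseteq> A" using 1(1) unfolding l_coset_Un by blast
    then have "g <#\<^bsub>G\<^esub> (inv g <#\<^bsub>G\<^esub> B) \<subseteq> g <#\<^bsub>G\<^esub> A" by (auto simp: l_coset_def)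
    then have "B \<subseteq> g <#\<^bsub>G\<^esub> A" by (simp add: cancel subB)
    moreover have "g <#\<^bsub>G\<^esub> A \<subseteq> B" using 2 A(2) unfolding l_coset_Un h by auto
    ultimately show "y = (g <#\<^bsub>G\<^esub> A, inv g)" by (simp add: yeq h)
  qed (use y in simp)
qed (use S_closed monoid.m_assoc[OF S_monoid] in auto)

subsection \<open>Generators\<close>

definition gen where "gen g = (H \<union> (inv g <#\<^bsub>G\<^esub> H), g)"

lemma gen_closed:
  assumes "g \<in> carrier G"
  shows "gen g \<in> carrier S"
  using assms lcos_self[OF _ subgroup, of "inv g"] by (simp add: gen_def S_carrier coset_P_H)

lemmas gen_simps = gen_def S_mult S_one l_coset_Un lcos_m_assoc lcos_mult_one l_coset_subset_G
  inv_mult_group m_assoc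

lemma inv_cancel:
  assumes "g \<in> carrier G" "x \<in> carrier G"
  shows "inv g \<otimes> (g \<otimes> x) = x" "g \<otimes> (inv g \<otimes> x) = x"
  using assms by (simp_all flip: m_assoc)

lemma gen_one: "gen \<one> = \<one>\<^bsub>S\<^esub>"
  by (simp add: gen_simps)

text \<open>The counterpart of e_g in the semigroup; products of these idempotents produce all the
  elements (A, 1).\<close>

lemma gen_gen_inv: "g \<in> carrier G \<Longrightarrow> gen g \<otimes>\<^bsub>S\<^esub> gen (inv g) = (H \<union> (g <#\<^bsub>G\<^esub> H), \<one>)"
  by (simp add: gen_simps) blast

text \<open>Both sides are (H \<union> g'^-1 H \<union> (gg')^-1 H, g'). The coset g'^-1 H, which
  \<open>gen g\<close> followed by \<open>gen g'\<close> has and \<open>gen (g \<otimes> g')\<close>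
  may lack, is supplied by \<open>gen (inv g)\<close>. The bracketing is the one in which words are
  evaluated.\<close>

lemma gen_left:
  assumes "g \<in> carrier G" "g' \<in> carrier G"
  shows "gen (inv g) \<otimes>\<^bsub>S\<^esub> (gen g \<otimes>\<^bsub>S\<^esub> gen g') = gen (inv g) \<otimes>\<^bsub>S\<^esub> gen (g \<otimes> g')"
  using assms by (simp add: gen_simps inv_cancel) blast

text \<open>Both sides are (H \<union> g'^-1 H \<union> gH, g').\<close>

lemma gen_right:
  assumes "g \<in> carrier G" "g' \<in> carrier G"
  shows "gen g' \<otimes>\<^bsub>S\<^esub> (gen g \<otimes>\<^bsub>S\<^esub> gen (inv g)) = gen (g' \<otimes> g) \<otimes>\<^bsub>S\<^esub> gen (inv g)"
  using assms by (simp add: gen_simps inv_cancel) blast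

lemma gen_H:
  assumes "h \<in> H"
  shows "gen h \<otimes>\<^bsub>S\<^esub> gen (inv h) = \<one>\<^bsub>S\<^esub>"
  using assms subgroup.mem_carrier[OF subgroup assms] coset_join3[OF _ subgroup assms]
  by (simp add: gen_gen_inv S_one)

text \<open>The value of a word of generators. Folding from the right lets each letter act by left
  multiplication, the case settled by \<open>\<Phi>_mult\<close>.\<close>

definition ev where "ev w = foldr (\<lambda>g x. gen g \<otimes>\<^bsub>S\<^esub> x) w \<one>\<^bsub>S\<^esub>"

lemma ev_simps [simp]: "ev [] = \<one>\<^bsub>S\<^esub>" "ev (g # w) = gen g \<otimes>\<^bsub>S\<^esub> ev w"
  by (simp_all add: ev_def)

lemma ev_closed: "w \<in> lists (carrier G) \<Longrightarrow> ev w \<in> carrier S"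
  using monoid.one_closed[OF S_monoid] by (induction w) (auto intro!: S_closed gen_closed)

lemma ev_append:
  assumes "u \<in> lists (carrier G)" "v \<in> lists (carrier G)"
  shows "ev (u @ v) = ev u \<otimes>\<^bsub>S\<^esub> ev v"
  using assms
proof (induction u)
  case Nil
  then show ?case using ev_closed monoid.l_one[OF S_monoid] by simp
next
  case (Cons g u)
  then show ?case using ev_closed gen_closed monoid.m_assoc[OF S_monoid] by simp
qed

text \<open>The product of the s_a s_(a^-1) over all a in A is (A, 1), because A is the union of the
  cosets of its points. A final s_g on the left adds only H and g^-1 H, both inside A.\<close>

lemma ev_surj:
  assumes "finite (carrier G)" "x \<in> carrier S"
  shows "\<exists>w \<in> lists (carrier G). ev w = x"
proof -
  have *: "\<exists>w \<in> lists (carrier G). ev w = (H \<union> (\<Union>a\<in>T. a <#\<^bsub>G\<^esub> H), \<one>)"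
    if "finite T" "T \<subseteq> carrier G" for T
    using that
  proof (induction T rule: finite_induct)
    case empty
    then show ?case by (intro bexI[of _ "[]"]) (simp_all add: S_one)
  next
    case (insert a T)
    then obtain w where w: "w \<in> lists (carrier G)" "ev w = (H \<union> (\<Union>a\<in>T. a <#\<^bsub>G\<^esub> H), \<one>)"
      by auto
    have a: "a \<in> carrier G" and T: "(\<Union>a\<in>T. a <#\<^bsub>G\<^esub> H) \<subseteq> carrier G"
      using insert.prems l_coset_subset_G[OF H_subset] by blast+
    have "ev [a, inv a] = (H \<union> (a <#\<^bsub>G\<^esub> H), \<one>)"
      using a gen_closed[of "inv a"] monoid.r_one[OF S_monoid] by (simp add: gen_gen_inv)
    then have "ev ([a, inv a] @ w) = (H \<union> (\<Union>a\<in>insert a T. a <#\<^bsub>G\<^esub> H), \<one>)"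
      using a w T by (subst ev_append)
        (auto simp: S_mult l_coset_Un lcos_mult_one l_coset_subset_G simp del: ev_simps)
    then show ?case using a w by (intro bexI[of _ "[a, inv a] @ w"]) auto
  qed
  obtain A g where eq: "x = (A, g)" by (cases x)
  have A: "A \<in> P_H G H" "g \<in> carrier G" "inv g \<in> A" using assms(2) by (simp_all add: eq S_carrier)
  have sub: "A \<subseteq> carrier G" by (rule P_H_subset[OF A(1)])
  have "H \<union> (\<Union>a\<in>A. a <#\<^bsub>G\<^esub> H) = A"
    using A(1) lcos_self[OF _ subgroup] unfolding P_H_iff[OF subgroup] by blast
  then obtain w where w: "w \<in> lists (carrier G)" "ev w = (A, \<one>)"
    using *[of A] finite_subset[OF sub assms(1)] sub by auto
  have "H \<union> (inv g <#\<^bsub>G\<^esub> H) \<union> A = A" using A P_H_coset[OF A(1,3)] by (auto simp: P_H_def)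
  then have "ev (g # w) = x"
    using A w by (simp add: eq gen_simps)
  then show ?thesis using w A by (intro bexI[of _ "g # w"]) auto
qed

end

section \<open>The isomorphism\<close>

text \<open>Each operation on \<open>B\<close> lifts along the surjection \<open>\<psi>\<close> to
  \<open>F\<close>, where the composite of \<open>\<phi>\<close> with \<open>\<psi>\<close> is the
  homomorphism \<open>\<pi>\<close>. Surjectivity of \<open>\<phi>\<close> comes from
  \<open>\<pi>\<close>, injectivity from the inclusion of kernels.\<close>

lemma complex_algebra_isoI:
  assumes F: "ring F" and B: "complex_algebra B" and C: "complex_algebra C"
    and \<psi>: "\<psi> \<in> ring_hom F B" "\<psi> ` carrier F = carrier B"
    and \<psi>_smult: "\<And>c f. f \<in> carrier F \<Longrightarrow> \<psi> (c \<odot>\<^bsub>F\<^esub> f) = c \<odot>\<^bsub>B\<^esub> \<psi> f"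
    and \<pi>: "\<pi> \<in> ring_hom F C" "\<pi> ` carrier F = carrier C"
    and \<pi>_smult: "\<And>c f. f \<in> carrier F \<Longrightarrow> \<pi> (c \<odot>\<^bsub>F\<^esub> f) = c \<odot>\<^bsub>C\<^esub> \<pi> f"
    and smult: "\<And>c f. f \<in> carrier F \<Longrightarrow> c \<odot>\<^bsub>F\<^esub> f \<in> carrier F"
    and \<phi>: "\<And>f. f \<in> carrier F \<Longrightarrow> \<phi> (\<psi> f) = \<pi> f"
    and ker: "\<And>f. f \<in> carrier F \<Longrightarrow> \<pi> f = \<zero>\<^bsub>C\<^esub> \<Longrightarrow> \<psi> f = \<zero>\<^bsub>B\<^esub>"
  shows "\<phi> \<in> complex_algebra_iso B C"
proof -
  interpret F: ring F by fact
  interpret B: ring B using B by (simp add: complex_algebra_def)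
  interpret C: ring C using C by (simp add: complex_algebra_def)
  interpret \<psi>: ring_hom_ring F B \<psi> by (intro ring_hom_ringI2 F.ring_axioms B.ring_axioms \<psi>(1))
  interpret \<pi>: ring_hom_ring F C \<pi> by (intro ring_hom_ringI2 F.ring_axioms C.ring_axioms \<pi>(1))
  have surj: "\<exists>f \<in> carrier F. x = \<psi> f" if "x \<in> carrier B" for x
    using that unfolding \<psi>(2)[symmetric] image_iff .
  have "\<phi> \<in> ring_hom B C"
  proof (rule ring_hom_memI)
    fix x y assume x: "x \<in> carrier B" and y: "y \<in> carrier B"
    obtain f where f: "f \<in> carrier F" "x = \<psi> f" using surj[OF x] ..
    obtain g where g: "g \<in> carrier F" "y = \<psi> g" using surj[OF y] ..
    show "\<phi> x \<in> carrier C" using f by (simp add: \<phi>)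
    show "\<phi> (x \<otimes>\<^bsub>B\<^esub> y) = \<phi> x \<otimes>\<^bsub>C\<^esub> \<phi> y"
      using \<phi>[of "f \<otimes>\<^bsub>F\<^esub> g"] f g by (simp add: \<phi>)
    show "\<phi> (x \<oplus>\<^bsub>B\<^esub> y) = \<phi> x \<oplus>\<^bsub>C\<^esub> \<phi> y"
      using \<phi>[of "f \<oplus>\<^bsub>F\<^esub> g"] f g by (simp add: \<phi>)
  next
    show "\<phi> \<one>\<^bsub>B\<^esub> = \<one>\<^bsub>C\<^esub>" using \<phi>[of "\<one>\<^bsub>F\<^esub>"] by simp
  qed
  moreover have "inj_on \<phi> (carrier B)"
  proof (rule inj_onI)
    fix x y assume x: "x \<in> carrier B" and y: "y \<in> carrier B" and eq: "\<phi> x = \<phi> y"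
    obtain f where f: "f \<in> carrier F" "x = \<psi> f" using surj[OF x] ..
    obtain g where g: "g \<in> carrier F" "y = \<psi> g" using surj[OF y] ..
    have "\<pi> f = \<pi> g" using eq f g by (simp add: \<phi>)
    then have "\<pi> (f \<oplus>\<^bsub>F\<^esub> \<ominus>\<^bsub>F\<^esub> g) = \<zero>\<^bsub>C\<^esub>" using f g by (simp add: C.r_neg)
    then have "\<psi> (f \<oplus>\<^bsub>F\<^esub> \<ominus>\<^bsub>F\<^esub> g) = \<zero>\<^bsub>B\<^esub>" using f g by (intro ker) auto
    then have "\<psi> f \<ominus>\<^bsub>B\<^esub> \<psi> g = \<zero>\<^bsub>B\<^esub>" using f g by (simp add: B.minus_eq)
    then show "x = y" using f g by (simp add: B.r_right_minus_eq)
  qed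
  moreover have "\<phi> ` carrier B = carrier C"
    unfolding \<psi>(2)[symmetric] \<pi>(2)[symmetric] image_image using \<phi> by (rule image_cong[OF refl])
  moreover have "\<phi> (c \<odot>\<^bsub>B\<^esub> x) = c \<odot>\<^bsub>C\<^esub> \<phi> x" if x: "x \<in> carrier B" for c x
  proof -
    obtain f where f: "f \<in> carrier F" "x = \<psi> f" using surj[OF x] ..
    then show ?thesis using \<phi>[OF smult[OF f(1), of c]] by (simp add: \<phi> \<psi>_smult \<pi>_smult)
  qed
  ultimately show ?thesis
    using B C by (simp add: complex_algebra_iso_def ring_iso_def bij_betw_def)
qed

lemma monoid_lists: "monoid \<lparr>carrier = lists Y, monoid.mult = (@), one = []\<rparr>"
  by (rule monoidI) auto

lemma complex_algebra_free_algebra: "complex_algebra (free_algebra Y)"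
  unfolding free_algebra_def by (rule complex_algebra_semigroup_algebra[OF monoid_lists])

lemma free_algebra_simps:
  "carrier (free_algebra Y) = {f. Poly_Mapping.keys f \<subseteq> lists Y}"
  "\<one>\<^bsub>free_algebra Y\<^esub> = word []"
  "f \<oplus>\<^bsub>free_algebra Y\<^esub> g = f + g"
  "c \<odot>\<^bsub>free_algebra Y\<^esub> f = Poly_Mapping.map ((*) c) f"
  "word u \<otimes>\<^bsub>free_algebra Y\<^esub> word v = word (u @ v)"
  by (simp_all add: free_algebra_def semigroup_algebra_simps word_def semigroup_algebra_mult_single)

lemma word_closed: "w \<in> lists Y \<Longrightarrow> word w \<in> carrier (free_algebra Y)"
  by (simp add: free_algebra_simps word_def)

lemma word_diff_closed:
  "u \<in> lists Y \<Longrightarrow> v \<in> lists Y \<Longrightarrow> word u - word v \<in> carrier (free_algebra Y)"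
  using keys_add_subset[of "word u" "lists Y" "- word v"]
  by (simp add: free_algebra_simps word_def in_keys_iff[abs_def] lookup_minus)

context group_subgroup
begin

section \<open>The partial group algebra as a quotient of the free algebra\<close>

abbreviation F where "F \<equiv> free_algebra (carrier G)"

abbreviation I where "I \<equiv> par_ideal G H"

abbreviation \<pi> where "\<pi> \<equiv> (\<lambda>f. I +>\<^bsub>F\<^esub> f)"

text \<open>Each relation is a difference of two words with the same value in the semigroup. This
  yields both that the relations lie in the free algebra and that \<open>\<psi>\<close> kills
  them.\<close>

lemma par_relations_cases:
  assumes "r \<in> par_relations G H"
  obtains u v where "r = word u - word v" "u \<in> lists (carrier G)" "v \<in> lists (carrier G)" "ev u = ev v"
proof -
  note one = monoid.l_one[OF S_monoid] monoid.r_one[OF S_monoid]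
  have "\<exists>u v. r = word u - word v \<and> u \<in> lists (carrier G) \<and> v \<in> lists (carrier G) \<and> ev u = ev v"
    using assms unfolding par_relations_def
  proof (elim UnE CollectE exE conjE)
    show ?thesis if "r \<in> {word [\<one>] - word []}"
      using that by (intro exI[of _ "[\<one>]"] exI[of _ "[]"])
        (simp add: gen_one one monoid.one_closed[OF S_monoid])
  next
    fix g assume "r = word [\<one>, g] - word [g]" "g \<in> carrier G"
    then show ?thesis by (intro exI[of _ "[\<one>, g]"] exI[of _ "[g]"]) (simp add: gen_one one gen_closed)
  next
    fix g assume "r = word [g, \<one>] - word [g]" "g \<in> carrier G"
    then show ?thesis by (intro exI[of _ "[g, \<one>]"] exI[of _ "[g]"])
        (simp add: gen_one one gen_closed monoid.one_closed[OF S_monoid])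
  next
    fix g g' assume "r = word [inv g, g, g'] - word [inv g, g \<otimes> g']" "g \<in> carrier G" "g' \<in> carrier G"
    then show ?thesis by (intro exI[of _ "[inv g, g, g']"] exI[of _ "[inv g, g \<otimes> g']"])
        (simp add: one gen_closed gen_left)
  next
    fix g g' assume "r = word [g', g, inv g] - word [g' \<otimes> g, inv g]" "g \<in> carrier G" "g' \<in> carrier G"
    then show ?thesis by (intro exI[of _ "[g', g, inv g]"] exI[of _ "[g' \<otimes> g, inv g]"])
        (simp add: one gen_closed gen_right)
  next
    fix h assume r: "r = word [h, inv h] - word [\<one>]" and h: "h \<in> H"
    have "h \<in> carrier G" using h by (rule subgroup.mem_carrier[OF subgroup])
    then show ?thesis using r h by (intro exI[of _ "[h, inv h]"] exI[of _ "[\<one>]"])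
        (simp add: one gen_closed gen_H gen_one monoid.one_closed[OF S_monoid])
  qed
  then show ?thesis using that by blast
qed

lemma F_alg: "complex_alg F"
  by (rule complex_algI[OF complex_algebra_free_algebra])

lemma F_ring: "ring F"
  using complex_algebra_free_algebra[of "carrier G"] by (simp add: complex_algebra_def)

lemma par_relations_closed: "par_relations G H \<subseteq> carrier F"
proof
  fix r assume "r \<in> par_relations G H"
  then show "r \<in> carrier F" by (rule par_relations_cases) (simp only: word_diff_closed)
qed

lemma I_ideal: "ideal I F"
  unfolding par_ideal_def by (rule ring.genideal_ideal[OF F_ring par_relations_closed])

lemma par_algebra_complex: "complex_algebra (par_algebra G H)"
  unfolding par_algebra_def by (rule complex_alg.complex_algebra_quotient_algebra[OF F_alg I_ideal])

lemma \<pi>_hom: "\<pi> \<in> ring_hom F (par_algebra G H)"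
  unfolding par_algebra_def by (rule complex_alg.quotient_algebra_hom[OF F_alg I_ideal])

lemma \<pi>_smult: "f \<in> carrier F \<Longrightarrow> \<pi> (c \<odot>\<^bsub>F\<^esub> f) = c \<odot>\<^bsub>par_algebra G H\<^esub> \<pi> f"
  unfolding par_algebra_def by (rule complex_alg.quotient_algebra_smult[OF F_alg I_ideal, symmetric])

lemma \<pi>_surj: "\<pi> ` carrier F = carrier (par_algebra G H)"
  unfolding par_algebra_def complex_alg.carrier_quotient_algebra[OF F_alg] ..

lemma par_algebra_zero: "\<zero>\<^bsub>par_algebra G H\<^esub> = I"
  by (simp add: par_algebra_def quotient_algebra_simps FactRing_def)

lemma \<pi>_word_append:
  assumes "u \<in> lists (carrier G)" "v \<in> lists (carrier G)"
  shows "\<pi> (word (u @ v)) = \<pi> (word u) \<otimes>\<^bsub>par_algebra G H\<^esub> \<pi> (word v)"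
  using ring_hom_mult[OF \<pi>_hom word_closed[OF assms(1)] word_closed[OF assms(2)]]
  by (simp add: free_algebra_simps)

lemma \<pi>_word_eq:
  assumes r: "word u - word v \<in> par_relations G H"
    and uv: "u \<in> lists (carrier G)" "v \<in> lists (carrier G)"
  shows "\<pi> (word u) = \<pi> (word v)"
proof -
  interpret P: ring "par_algebra G H" using par_algebra_complex by (simp add: complex_algebra_def)
  interpret I: ideal I F by (rule I_ideal)
  have "word u - word v \<in> I"
    unfolding par_ideal_def using ring.genideal_self[OF F_ring par_relations_closed] r by (rule subsetD)
  then have "\<pi> (word u - word v) = \<zero>\<^bsub>par_algebra G H\<^esub>"
    unfolding par_algebra_zero by (rule I.a_rcos_const)
  moreover have "word u = (word u - word v) \<oplus>\<^bsub>F\<^esub> word v"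
    by (simp add: free_algebra_simps)
  ultimately show ?thesis
    using ring_hom_add[OF \<pi>_hom word_diff_closed[OF uv] word_closed[OF uv(2)]]
      ring_hom_closed[OF \<pi>_hom word_closed[OF uv(2)]] by simp
qed

lemma par_gen_eq: "par_gen G H g = \<pi> (word [g])"
  by (simp add: par_gen_def)

lemma partial_rep_par_gen:
  assumes "finite (carrier G)"
  shows "partial_rep G (par_algebra G H) H (par_gen G H)"
proof -
  interpret P: ring "par_algebra G H" using par_algebra_complex by (simp add: complex_algebra_def)
  have append: "\<pi> (word [a, b]) = par_gen G H a \<otimes>\<^bsub>par_algebra G H\<^esub> par_gen G H b"
    "\<pi> (word [a, b, c]) = par_gen G H a \<otimes>\<^bsub>par_algebra G H\<^esub> par_gen G H b \<otimes>\<^bsub>par_algebra G H\<^esub> par_gen G H c"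
    if "a \<in> carrier G" "b \<in> carrier G" "c \<in> carrier G" for a b c
    using that \<pi>_word_append[of "[a]" "[b]"] \<pi>_word_append[of "[a, b]" "[c]"]
    by (simp_all add: par_gen_eq)
  have one: "\<pi> (word []) = \<one>\<^bsub>par_algebra G H\<^esub>"
    using ring_hom_one[OF \<pi>_hom] by (simp add: free_algebra_simps)
  show ?thesis
  proof (intro partial_rep.intro partial_rep_axioms.intro)
    show "group G" "ring (par_algebra G H)" by (fact group_axioms P.ring_axioms)+
    show "finite (carrier G)" "subgroup H G" by (fact assms subgroup)+
    show "par_gen G H \<one> = \<one>\<^bsub>par_algebra G H\<^esub>"
      unfolding one[symmetric] par_gen_eq
      by (rule \<pi>_word_eq) (simp_all add: par_relations_def)
    fix g assume g: "g \<in> carrier G"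
    show "par_gen G H g \<in> carrier (par_algebra G H)"
      unfolding par_gen_eq using g by (intro ring_hom_closed[OF \<pi>_hom] word_closed) simp
    fix g' assume g': "g' \<in> carrier G"
    have "\<pi> (word [inv g, g, g']) = \<pi> (word [inv g, g \<otimes> g'])"
      using g g' by (intro \<pi>_word_eq) (unfold par_relations_def, blast, simp_all)
    then show "par_gen G H (inv g) \<otimes>\<^bsub>par_algebra G H\<^esub> par_gen G H g \<otimes>\<^bsub>par_algebra G H\<^esub> par_gen G H g' =
        par_gen G H (inv g) \<otimes>\<^bsub>par_algebra G H\<^esub> par_gen G H (g \<otimes> g')"
      using g g' by (simp add: append)
    have "\<pi> (word [g', g, inv g]) = \<pi> (word [g' \<otimes> g, inv g])"
      using g g' by (intro \<pi>_word_eq) (unfold par_relations_def, blast, simp_all)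
    then show "par_gen G H g' \<otimes>\<^bsub>par_algebra G H\<^esub> par_gen G H g \<otimes>\<^bsub>par_algebra G H\<^esub> par_gen G H (inv g) =
        par_gen G H (g' \<otimes> g) \<otimes>\<^bsub>par_algebra G H\<^esub> par_gen G H (inv g)"
      using g g' by (simp add: append)
  next
    fix h assume h: "h \<in> H"
    then have hG: "h \<in> carrier G" by (rule subgroup.mem_carrier[OF subgroup])
    have "\<pi> (word [h, inv h]) = \<pi> (word [\<one>])"
      using h hG by (intro \<pi>_word_eq) (unfold par_relations_def, blast, simp_all)
    \<comment> \<open>The relation for \<open>h\<close> ends at the letter [1], which the relation
      [1] = 1 then identifies with the unit.\<close>
    moreover have "\<pi> (word [\<one>]) = \<pi> (word [])"
      by (rule \<pi>_word_eq) (simp_all add: par_relations_def)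
    ultimately show "par_gen G H h \<otimes>\<^bsub>par_algebra G H\<^esub> par_gen G H (inv h) = \<one>\<^bsub>par_algebra G H\<^esub>"
      using hG by (simp add: append one)
  qed
qed

subsection \<open>The homomorphism from the free algebra to the semigroup algebra\<close>

abbreviation CS where "CS \<equiv> semigroup_algebra S"

definition \<psi> where "\<psi> = linear_extension CS (\<lambda>w. Poly_Mapping.single (ev w) 1)"

lemma CS_complex: "complex_algebra CS"
  by (rule complex_algebra_semigroup_algebra[OF S_monoid])

lemma CS_alg: "complex_alg CS"
  by (rule complex_algI[OF CS_complex])

lemma single_ev_closed:
  "(\<lambda>w. Poly_Mapping.single (ev w) 1) \<in> lists (carrier G) \<rightarrow> carrier CS"
  using ev_closed by (auto simp: semigroup_algebra_simps)

lemma \<psi>_hom: "\<psi> \<in> ring_hom F CS"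
  unfolding \<psi>_def free_algebra_def
proof (rule complex_alg.linear_extension_ring_hom[OF CS_alg monoid_lists])
  show "(\<lambda>w. Poly_Mapping.single (ev w) 1)
      \<in> hom \<lparr>carrier = lists (carrier G), monoid.mult = (@), one = []\<rparr> CS"
    using single_ev_closed
    by (simp add: hom_def semigroup_algebra_mult_single ev_append)
qed (simp add: semigroup_algebra_simps)

lemma \<psi>_smult: "f \<in> carrier F \<Longrightarrow> \<psi> (c \<odot>\<^bsub>F\<^esub> f) = c \<odot>\<^bsub>CS\<^esub> \<psi> f"
  unfolding \<psi>_def free_algebra_simps
  by (rule complex_alg.linear_extension_smult[OF CS_alg single_ev_closed]) simp

lemma \<psi>_single:
  assumes "w \<in> lists (carrier G)"
  shows "\<psi> (Poly_Mapping.single w c) = Poly_Mapping.single (ev w) c"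
  unfolding \<psi>_def using single_ev_closed assms
  by (subst complex_alg.linear_extension_single[OF CS_alg])
    (auto simp: semigroup_algebra_simps)

text \<open>A multiple of a basis element is the image of the same multiple of a word that evaluates
  to it; sums follow by additivity.\<close>

lemma \<psi>_surj:
  assumes "finite (carrier G)"
  shows "\<psi> ` carrier F = carrier CS"
proof
  show "\<psi> ` carrier F \<subseteq> carrier CS" using ring_hom_closed[OF \<psi>_hom] by blast
  have "x \<in> \<psi> ` carrier F" if "Poly_Mapping.keys x \<subseteq> carrier S" for x
    using that
  proof (induction x rule: poly_mapping_keys_induct)
    case zero
    show ?case
      using ring.ring_simprules(2)[OF F_ring] complex_alg.linear_extension_zero[OF CS_alg]
      by (intro image_eqI[of _ _ 0]) (auto simp: \<psi>_def free_algebra_simps semigroup_algebra_simps)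
  next
    case (single s c)
    then obtain w where w: "w \<in> lists (carrier G)" "ev w = s" using ev_surj[OF assms] by blast
    then show ?case
      by (intro image_eqI[of _ _ "Poly_Mapping.single w c"])
        (simp_all add: \<psi>_single free_algebra_simps)
  next
    case (add x y)
    then obtain f g where "f \<in> carrier F" "x = \<psi> f" "g \<in> carrier F" "y = \<psi> g" by blast
    then show ?case
      using ring_hom_add[OF \<psi>_hom, of f g] ring.ring_simprules(1)[OF F_ring, of f g]
      by (intro image_eqI[of _ _ "f + g"]) (simp_all add: free_algebra_simps semigroup_algebra_simps)
  qed
  then show "carrier CS \<subseteq> \<psi> ` carrier F" by (auto simp: semigroup_algebra_simps)
qed

text \<open>The kernel of \<open>\<psi>\<close> is an ideal containing the relations, and
  \<open>I\<close> is the least such ideal.\<close>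

lemma \<psi>_par_ideal:
  assumes "f \<in> I"
  shows "\<psi> f = \<zero>\<^bsub>CS\<^esub>"
proof -
  interpret CS: ring CS using CS_complex by (simp add: complex_algebra_def)
  interpret \<psi>: ring_hom_ring F CS \<psi> by (intro ring_hom_ringI2 F_ring CS.ring_axioms \<psi>_hom)
  have "\<psi> r = \<zero>\<^bsub>CS\<^esub>" if r: "r \<in> par_relations G H" for r
  proof -
    obtain u v where uv: "r = word u - word v" "u \<in> lists (carrier G)" "v \<in> lists (carrier G)"
      "ev u = ev v" using par_relations_cases[OF r] by metis
    \<comment> \<open>The relation is read as word u = r + word v, so that additivity of
      \<open>\<psi>\<close> suffices.\<close>
    have "\<psi> (word u) = \<psi> r \<oplus>\<^bsub>CS\<^esub> \<psi> (word v)"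
      using ring_hom_add[OF \<psi>_hom word_diff_closed[OF uv(2,3)] word_closed[OF uv(3)]]
      by (simp add: free_algebra_simps uv(1))
    then show ?thesis
      using uv by (simp add: word_def \<psi>_single semigroup_algebra_simps)
  qed
  then have "par_relations G H \<subseteq> a_kernel F CS \<psi>"
    using par_relations_closed unfolding a_kernel_def' by (auto simp only: subset_eq mem_Collect_eq)
  then have "I \<subseteq> a_kernel F CS \<psi>"
    unfolding par_ideal_def by (intro ring.genideal_minimal[OF F_ring] \<psi>.kernel_is_ideal)
  then show ?thesis using assms unfolding a_kernel_def' by (simp only: subset_eq mem_Collect_eq)
qed

lemma linear_extension_par_algebra_iso:
  assumes "finite (carrier G)"
  shows "linear_extension (par_algebra G H)
      (\<lambda>(A, g). \<Oplus>\<^bsub>par_algebra G H\<^esub>B \<in> {B \<in> P_H G H. A \<subseteq> B}.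
         par_gen G H g \<otimes>\<^bsub>par_algebra G H\<^esub> par_P G H B)
    \<in> complex_algebra_iso CS (par_algebra G H)"
proof -
  interpret P: complex_alg "par_algebra G H" by (rule complex_algI[OF par_algebra_complex])
  interpret I: ideal I F by (rule I_ideal)
  interpret rep: partial_rep G "par_algebra G H" H "par_gen G H"
    by (rule partial_rep_par_gen[OF assms])
  \<comment> \<open>An equality of functions, so that the lambda term of the theorem can be
    rewritten to \<open>rep.\<Phi>\<close> as a whole.\<close>
  have "par_idem G H = rep.e"
    by (rule ext) (simp add: par_idem_def rep.e_def)
  then have \<Phi>: "(\<lambda>(A, g). \<Oplus>\<^bsub>par_algebra G H\<^esub>B \<in> {B \<in> P_H G H. A \<subseteq> B}.
      par_gen G H g \<otimes>\<^bsub>par_algebra G H\<^esub> par_P G H B) = rep.\<Phi>"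
    by (simp add: rep.\<Phi>_def par_P_def)
  have \<Phi>_closed: "rep.\<Phi> \<in> carrier S \<rightarrow> carrier (par_algebra G H)"
    using rep.\<Phi>_closed by (rule Pi_I)
  \<comment> \<open>This is phi o psi = pi on words. The first letter is split off by
    \<open>\<Phi>_mult\<close> on the left and by \<open>\<pi>_word_append\<close> on the
    right.\<close>
  have \<Phi>_ev: "rep.\<Phi> (ev w) = \<pi> (word w)" if "w \<in> lists (carrier G)" for w
    using that
  proof (induction w)
    case Nil
    then show ?case
      using rep.\<Phi>_one ring_hom_one[OF \<pi>_hom] by (simp add: S_one free_algebra_simps)
  next
    case (Cons g w)
    then have g: "g \<in> carrier G" and w: "w \<in> lists (carrier G)" by auto
    obtain B h where Bh: "ev w = (B, h)" by (cases "ev w")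
    then have B: "B \<in> P_H G H" "h \<in> carrier G" "inv h \<in> B"
      using ev_closed[OF w] by (simp_all add: S_carrier)
    have "ev (g # w) = ((inv h <#\<^bsub>G\<^esub> (H \<union> (inv g <#\<^bsub>G\<^esub> H))) \<union> B, g \<otimes> h)"
      by (simp add: Bh gen_def S_mult)
    then have "rep.\<Phi> (ev (g # w)) = par_gen G H g \<otimes>\<^bsub>par_algebra G H\<^esub> rep.\<Phi> (ev w)"
      using rep.\<Phi>_mult[OF g B] P_H_l_coset_Un[OF coset_P_H B(1)] g B by (simp add: Bh)
    then show ?case
      using Cons.IH w g \<pi>_word_append[of "[g]" w, folded par_gen_eq] by simp
  qed
  show ?thesis
    unfolding \<Phi>
  proof (rule complex_algebra_isoI[OF F_ring CS_complex par_algebra_complex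
        \<psi>_hom \<psi>_surj[OF assms] \<psi>_smult \<pi>_hom \<pi>_surj \<pi>_smult complex_alg.smult_closed[OF F_alg]])
    fix f assume f: "f \<in> carrier F"
    then have "Poly_Mapping.keys f \<subseteq> lists (carrier G)" by (simp add: free_algebra_simps)
    \<comment> \<open>Both sides are linear in \<open>f\<close>, so the agreement on words extends
      to the whole free algebra.\<close>
    then show "linear_extension (par_algebra G H) rep.\<Phi> (\<psi> f) = \<pi> f"
    proof (induction f rule: poly_mapping_keys_induct)
      case zero
      have "\<psi> 0 = 0" using complex_alg.linear_extension_zero[OF CS_alg]
        by (simp add: \<psi>_def semigroup_algebra_simps)
      moreover have "\<pi> 0 = \<zero>\<^bsub>par_algebra G H\<^esub>"
        using ring_hom_zero[OF \<pi>_hom F_ring P.ring_axioms]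
        by (simp add: free_algebra_def semigroup_algebra_simps)
      ultimately show ?case by simp
    next
      case (single w c)
      have "Poly_Mapping.single w c = c \<odot>\<^bsub>F\<^esub> word w"
        by (simp add: free_algebra_simps word_def)
      then have "\<pi> (Poly_Mapping.single w c) = c \<odot>\<^bsub>par_algebra G H\<^esub> \<pi> (word w)"
        using \<pi>_smult[OF word_closed[OF single]] by simp
      also have "\<dots> = c \<odot>\<^bsub>par_algebra G H\<^esub> rep.\<Phi> (ev w)"
        by (simp only: \<Phi>_ev[OF single])
      also have "\<dots> = linear_extension (par_algebra G H) rep.\<Phi> (\<psi> (Poly_Mapping.single w c))"
        unfolding \<psi>_single[OF single]
        by (rule P.linear_extension_single[symmetric]) (rule rep.\<Phi>_closed[OF ev_closed[OF single]])
      finally show ?case ..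
    next
      case (add f g)
      then have f: "f \<in> carrier F" and g: "g \<in> carrier F" by (simp_all add: free_algebra_simps)
      then have "Poly_Mapping.keys (\<psi> f) \<subseteq> carrier S" "Poly_Mapping.keys (\<psi> g) \<subseteq> carrier S"
        using ring_hom_closed[OF \<psi>_hom] by (auto simp: semigroup_algebra_simps)
      then show ?case
        using ring_hom_add[OF \<psi>_hom f g] ring_hom_add[OF \<pi>_hom f g] add.IH
          P.linear_extension_add[OF \<Phi>_closed]
        by (simp add: free_algebra_simps semigroup_algebra_simps)
    qed
  next
    fix f assume "f \<in> carrier F" "\<pi> f = \<zero>\<^bsub>par_algebra G H\<^esub>"
    \<comment> \<open>The zero coset is \<open>I\<close> itself, so the kernel of the projection is
      \<open>I\<close>.\<close>
    then have "f \<in> I" unfolding par_algebra_zero by (intro I.rcos_const_imp_mem)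
    then show "\<psi> f = \<zero>\<^bsub>CS\<^esub>" by (rule \<psi>_par_ideal)
  qed
qed

end

theorem mainTheorem9:
  fixes G :: "('a, 'm) monoid_scheme" and H :: "'a set"
  assumes "group G" and "finite (carrier G)" and "subgroup H G"
  shows "inverse_semigroup (S_H G H) \<and>
    linear_extension (par_algebra G H)
      (\<lambda>(A, g). \<Oplus>\<^bsub>par_algebra G H\<^esub>B \<in> {B \<in> P_H G H. A \<subseteq> B}.
         par_gen G H g \<otimes>\<^bsub>par_algebra G H\<^esub> par_P G H B)
    \<in> complex_algebra_iso (semigroup_algebra (S_H G H)) (par_algebra G H)"
proof -
  interpret group_subgroup G H
    using assms by (simp add: group_subgroup_def group_subgroup_axioms_def)
  show ?thesis using inverse_semigroup_S linear_extension_par_algebra_iso[OF assms(2)] by blast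
qed

end
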